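(* Assume the Degree 2 Shortcode Soundness Hypothesis (SSH) holds. Then the Grassmann Soundness Hypothesis (GSH) holds. (SSH): For every $\delta>0$ there exist $\epsilon>0$ and an integer $r>0$ such that the following holds for sufficiently large $n\gg\ell$. Let $F:\mathsf{Mat}_{\ell,n}\to\mathbb{F}_2^{\ell}$ satisfy $\Pr_{M\sim\mathsf{Mat}_{\ell,n},\,a\sim\mathbb{F}_2^{\ell},\,b\sim\mathbb{F}_2^{n}}[F(M+ab^{\top})\in\{F(M),F(M)+a\}]\ge\delta$. Then there exist $q_1,\dots,q_r\in\mathbb{F}_2^n$, $t_1,\dots,t_r\in\mathbb{F}_2^{\ell}$, $p_1,\dots,p_r\in\mathbb{F}_2^{\ell}$, $s_1,\dots,s_r\in\mathbb{F}_2^{n}$, $z\in\mathbb{F}_2^n$ and $u\in\mathbb{F}_2^{\ell}$ such that $\Pr_{M\sim\mathsf{Mat}_{\ell,n}}[F(M)=Mz+u \mid Mq_i=t_i,\ p_i^{\top}M=s_i^{\top}\ \forall i\le r]\ge\epsilon.$ (GSH): For every $\delta>0$ there exist $\epsilon>0$ and an integer $r>0$ such that the following holds for sufficiently large $n\gg\ell$. Let $F$ assign to each $V\in\mathcal{V}_{\ell}$ a linear function $F(V):V\to\mathbb{F}_2$, and suppose $\Pr_{(V,V')}[F(V)|_{V\cap V'}=F(V')|_{V\cap V'}]\ge\delta$, where $(V,V')$ is a uniformly random edge of $\mathcal{G}(\ell,n)$. Then there exist subspaces $Q,W\subseteq\mathbb{F}_2^n$ of dimensions $r$ and $n-r$ respectively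 and a linear function $f:\mathbb{F}_2^n\to\mathbb{F}_2$ such that $\Pr_{V\sim\mathcal{V}_{\ell},\,Q\subseteq V\subseteq W}[F(V)=f|_V]\ge\epsilon$ (here $V$ is uniform among $\ell$-dimensional subspaces with $Q\subseteq V\subseteq W$).
   Context: $\mathsf{Mat}_{\ell,n}$ denotes the set of all $\ell\times n$ matrices over $\mathbb{F}_2$; samples denoted $x\sim X$ are uniform over the finite set $X$ and independent. $\mathcal{V}_{\ell}$ is the set of all $\ell$-dimensional subspaces of $\mathbb{F}_2^n$. The Grassmann graph $\mathcal{G}(\ell,n)$ has vertex set $\mathcal{V}_{\ell}$, with $V,V'$ adjacent iff $\dim(V\cap V')=\ell-1$. For a function $g$ on a space containing $U$, $g|_U$ denotes its restriction to $U$. *)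

theory Defs
  imports
    "HOL-Probability.Probability_Mass_Function"
    "HOL-Library.Z2"
    "Jordan_Normal_Form.VS_Connect"
begin

text \<open>The field $F_2$ is the type \<^typ>\<open>bit\<close>; $F_2^n$ is \<^term>\<open>carrier_vec n :: bit vec set\<close> and the
  \<open>l \<times> n\<close> matrices over $F_2$ are \<^term>\<open>carrier_mat l n :: bit mat set\<close>.\<close>

text \<open>The rank-one matrix $a b^T$.\<close>

definition outer_prod :: "'a::times vec \<Rightarrow> 'a vec \<Rightarrow> 'a mat" where
  "outer_prod a b = mat (dim_vec a) (dim_vec b) (\<lambda>(i, j). a $ i * b $ j)"

definition vsubspace :: "nat \<Rightarrow> bit vec set \<Rightarrow> bool" where
  "vsubspace n V \<longleftrightarrow> VectorSpace.subspace class_ring V (module_vec TYPE(bit) n)"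

definition vdim :: "nat \<Rightarrow> bit vec set \<Rightarrow> nat" where
  "vdim n V = vectorspace.dim class_ring (module_vec TYPE(bit) n\<lparr>carrier := V\<rparr>)"

definition grassmann :: "nat \<Rightarrow> nat \<Rightarrow> bit vec set set" where
  "grassmann l n = {V. vsubspace n V \<and> vdim n V = l}"

text \<open>Edges are ordered pairs; as adjacency is symmetric and irreflexive, every undirected edge
  is represented exactly twice, so that the uniform distributions agree.  Writing the condition
  as \<open>dim (V \<inter> V') + 1 = l\<close> avoids truncated subtraction at \<open>l = 0\<close>.\<close>

definition grassmann_edges :: "nat \<Rightarrow> nat \<Rightarrow> (bit vec set \<times> bit vec set) set" where
  "grassmann_edges l n =
     {(V, V'). V \<in> grassmann l n \<and> V' \<in> grassmann l n \<and> vdim n (V \<inter> V') + 1 = l}"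

text \<open>Only the values of \<open>f\<close> on \<open>V\<close> matter, so \<open>f\<close> represents a linear function \<open>V \<rightarrow> F\<^sub>2\<close>.\<close>

definition linear_functional_on :: "bit vec set \<Rightarrow> (bit vec \<Rightarrow> bit) \<Rightarrow> bool" where
  "linear_functional_on V f \<longleftrightarrow>
     (\<forall>x\<in>V. \<forall>y\<in>V. f (x + y) = f x + f y) \<and> (\<forall>c. \<forall>x\<in>V. f (c \<cdot>\<^sub>v x) = c * f x)"

text \<open>\<open>Sufficiently large n \<gg> l\<close> means: for all large enough \<open>l\<close>, and then for all \<open>n\<close> large enough
  depending on \<open>l\<close>; both thresholds may depend on \<open>\<delta>\<close>, \<open>\<epsilon>\<close> and \<open>r\<close>.  A conditional probability
  given an empty event is 0 by the library convention, so a positive lower bound on it entails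
  that the conditioning event is nonempty.\<close>

definition shortcode_soundness_hypothesis :: bool where
  "shortcode_soundness_hypothesis \<longleftrightarrow>
    (\<forall>\<delta>::real. \<delta> > 0 \<longrightarrow> (\<exists>(\<epsilon>::real) (r::nat). \<epsilon> > 0 \<and> r > 0 \<and>
      (\<forall>\<^sub>F l in sequentially. \<forall>\<^sub>F n in sequentially.
        \<forall>F :: bit mat \<Rightarrow> bit vec.
          F \<in> carrier_mat l n \<rightarrow> carrier_vec l \<longrightarrow>
          \<P>(x in pmf_of_set (carrier_mat l n \<times> carrier_vec l \<times> carrier_vec n).
              case x of (M, a, b) \<Rightarrow> F (M + outer_prod a b) \<in> {F M, F M + a}) \<ge> \<delta> \<longrightarrow>
          (\<exists>q t p s z u.
             (\<forall>i<r. q i \<in> carrier_vec n \<and> t i \<in> carrier_vec l \<and>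
                    p i \<in> carrier_vec l \<and> s i \<in> carrier_vec n) \<and>
             z \<in> carrier_vec n \<and> u \<in> carrier_vec l \<and>
             \<P>(M in pmf_of_set (carrier_mat l n). F M = M *\<^sub>v z + u \<bar>
                 \<forall>i<r. M *\<^sub>v q i = t i \<and> transpose_mat M *\<^sub>v p i = s i) \<ge> \<epsilon>))))"

definition grassmann_soundness_hypothesis :: bool where
  "grassmann_soundness_hypothesis \<longleftrightarrow>
    (\<forall>\<delta>::real. \<delta> > 0 \<longrightarrow> (\<exists>(\<epsilon>::real) (r::nat). \<epsilon> > 0 \<and> r > 0 \<and>
      (\<forall>\<^sub>F l in sequentially. \<forall>\<^sub>F n in sequentially.
        \<forall>F :: bit vec set \<Rightarrow> bit vec \<Rightarrow> bit.
          (\<forall>V\<in>grassmann l n. linear_functional_on V (F V)) \<longrightarrow>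
          \<P>(e in pmf_of_set (grassmann_edges l n).
              case e of (V, V') \<Rightarrow> restrict (F V) (V \<inter> V') = restrict (F V') (V \<inter> V')) \<ge> \<delta> \<longrightarrow>
          (\<exists>Q W f.
             vsubspace n Q \<and> vdim n Q = r \<and>
             vsubspace n W \<and> vdim n W = n - r \<and>
             linear_functional_on (carrier_vec n) f \<and>
             \<P>(V in pmf_of_set (grassmann l n). restrict (F V) V = restrict f V \<bar>
                 Q \<subseteq> V \<and> V \<subseteq> W) \<ge> \<epsilon>))))"

end

theory Submission
  imports Defs
begin

text \<open>Write \<open>n = l + m\<close> and attach to a matrix \<open>M \<in> Mat\<^bsub>l,m\<^esub>\<close> the row space \<open>V\<^sub>M\<close> of \<open>[1 | M]\<close>, which is
  \<open>l\<close>-dimensional whatever \<open>M\<close> is.  Recording the values of \<open>F(V\<^sub>M)\<close> on the rows of \<open>[1 | M]\<close> turns an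
  assignment \<open>F\<close> into a map \<open>F' : Mat\<^bsub>l,m\<^esub> \<rightarrow> F\<^sub>2\<^sup>l\<close>, and consistency of \<open>F\<close> on the edge
  \<open>(V\<^sub>M, V\<^bsub>M + a b\<^sup>T\<^esub>)\<close> means exactly \<open>F'(M + a b\<^sup>T) \<in> {F'(M), F'(M) + a}\<close>.  Since \<open>GL\<^sub>n\<close> acts transitively
  on the edges of the Grassmann graph, some linear change of coordinates makes \<open>F'\<close> pass the shortcode
  test at least as often as \<open>F\<close> passes the edge test.

  The shortcode conclusion is linear in terms of \<open>V\<^sub>M\<close>: \<open>M q = t\<close> says that \<open>V\<^sub>M\<close> is orthogonal to
  \<open>(t, q)\<close>, \<open>p\<^sup>T M = s\<^sup>T\<close> says that \<open>(p, s) \<in> V\<^sub>M\<close>, and \<open>F'(M) = M z + u\<close> says that \<open>F(V\<^sub>M)\<close> is the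
  restriction of \<open>x \<mapsto> \<langle>(u, z), x\<rangle>\<close>.  Enlarging the spans of the \<open>p\<^sub>i\<close> and of the \<open>q\<^sub>i\<close> to dimension exactly
  \<open>r\<close> and averaging over the values of \<open>M\<close> there yields \<open>Q\<close> and \<open>W\<close>.  Finally the spaces \<open>V\<^sub>M\<close> between
  \<open>Q\<close> and \<open>W\<close> number at least \<open>2\<^bsup>lm - rm - rl\<^esup>\<close>, while counting ordered bases bounds the number of all
  \<open>l\<close>-dimensional spaces between them by \<open>4 \<cdot> 2\<^bsup>(m - r)(l - r)\<^esup>\<close>; the quotient depends only on \<open>r\<close>.\<close>

no_notation inner (infix "\<bullet>" 70)

section \<open>Subspaces of the binary vector spaces and their cardinalities\<close>

lemma UNIV_bit: "(UNIV :: bit set) = {0, 1}"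
  by (auto intro: bit.exhaust)

lemma card_UNIV_bit: "card (UNIV :: bit set) = 2"
  by (simp add: UNIV_bit)

lemma bit_add_self [simp]: "x + x = (0::bit)"
  by (cases x) simp_all

declare add_bit_eq_xor [simp del] mult_bit_eq_and [simp del]

section \<open>Cardinalities of binary vector and matrix spaces\<close>

lemma bij_betw_carrier_vec:
  "bij_betw (\<lambda>v. restrict (($) v) {..<n}) (carrier_vec n) ({..<n} \<rightarrow>\<^sub>E UNIV)"
proof (rule bij_betwI[where g = "vec n"])
  show "vec n \<in> ({..<n} \<rightarrow>\<^sub>E UNIV) \<rightarrow> carrier_vec n" by simp
qed (auto simp: fun_eq_iff PiE_def extensional_def)

lemma bij_betw_carrier_mat:
  "bij_betw (\<lambda>M. restrict (($$) M) ({..<l} \<times> {..<m})) (carrier_mat l m)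
     ({..<l} \<times> {..<m} \<rightarrow>\<^sub>E UNIV)"
proof (rule bij_betwI[where g = "mat l m"])
  show "mat l m \<in> ({..<l} \<times> {..<m} \<rightarrow>\<^sub>E UNIV) \<rightarrow> carrier_mat l m" by simp
qed (auto simp: fun_eq_iff PiE_def extensional_def)

lemma finite_carrier_vec_bit [simp]: "finite (carrier_vec n :: bit vec set)"
  using bij_betw_finite[OF bij_betw_carrier_vec[of n, where 'a = bit]]
  by (simp add: UNIV_bit finite_PiE)

lemma card_carrier_vec_bit: "card (carrier_vec n :: bit vec set) = 2 ^ n"
  using bij_betw_same_card[OF bij_betw_carrier_vec[of n, where 'a = bit]]
  by (simp add: card_PiE card_UNIV_bit)

lemma finite_carrier_mat_bit [simp]: "finite (carrier_mat l m :: bit mat set)"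
  using bij_betw_finite[OF bij_betw_carrier_mat[of l m, where 'a = bit]]
  by (simp add: UNIV_bit finite_PiE)

lemma card_carrier_mat_bit: "card (carrier_mat l m :: bit mat set) = 2 ^ (l * m)"
  using bij_betw_same_card[OF bij_betw_carrier_mat[of l m, where 'a = bit]]
  by (simp add: card_PiE card_UNIV_bit)

lemma bit_vec_add_self: "x \<in> carrier_vec n \<Longrightarrow> x + x = (0\<^sub>v n :: bit vec)"
  by (intro eq_vecI) auto

lemma bit_vec_add_cancel: 
  "x \<in> carrier_vec n \<Longrightarrow> y \<in> carrier_vec n \<Longrightarrow> x + (x + y) = (y :: bit vec)"
  by (simp add: assoc_add_vec[of _ n, symmetric] bit_vec_add_self)

section \<open>Subspaces, with dimension expressed by cardinality\<close>

text \<open>The only scalars are 0 and 1, so closure under scaling comes down to containing the zero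
  vector.\<close>

lemma vsubspace_iff:
  "vsubspace n V \<longleftrightarrow> V \<subseteq> carrier_vec n \<and> 0\<^sub>v n \<in> V \<and> (\<forall>x\<in>V. \<forall>y\<in>V. x + y \<in> V)"
proof
  assume "vsubspace n V"
  then interpret subspace class_ring V "module_vec TYPE(bit) n"
    by (simp add: vsubspace_def)
  interpret submodule class_ring V "module_vec TYPE(bit) n"
    by (rule submod)
  show "V \<subseteq> carrier_vec n \<and> 0\<^sub>v n \<in> V \<and> (\<forall>x\<in>V. \<forall>y\<in>V. x + y \<in> V)"
    using subset zero_closed m_closed by (simp add: module_vec_simps)
next
  assume V: "V \<subseteq> carrier_vec n \<and> 0\<^sub>v n \<in> V \<and> (\<forall>x\<in>V. \<forall>y\<in>V. x + y \<in> V)"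
  have "c \<cdot>\<^sub>v x \<in> V" if "x \<in> V" for c x
  proof (cases "c = 0")
    case True
    have "0 \<cdot>\<^sub>v x = 0\<^sub>v n" using V that by (intro eq_vecI) auto
    then show ?thesis using True V by simp
  qed (use that in simp)
  then show "vsubspace n V"
    unfolding vsubspace_def VectorSpace.subspace_def
    using V by (auto intro!: vec_vs submodule.intro vec_module simp: module_vec_simps)
qed

lemma vsubspaceI:
  assumes "V \<subseteq> carrier_vec n" "0\<^sub>v n \<in> V" "\<And>x y. x \<in> V \<Longrightarrow> y \<in> V \<Longrightarrow> x + y \<in> V"
  shows "vsubspace n V"
  using assms by (auto simp: vsubspace_iff)

lemma vsubspace_subset: "vsubspace n V \<Longrightarrow> V \<subseteq> carrier_vec n"
  and vsubspace_zero: "vsubspace n V \<Longrightarrow> 0\<^sub>v n \<in> V"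
  and vsubspace_add: "vsubspace n V \<Longrightarrow> x \<in> V \<Longrightarrow> y \<in> V \<Longrightarrow> x + y \<in> V"
  by (auto simp: vsubspace_iff)

lemma vsubspace_carrier: "vsubspace n V \<Longrightarrow> x \<in> V \<Longrightarrow> x \<in> carrier_vec n"
  by (auto simp: vsubspace_iff)

lemma finite_vsubspace: "vsubspace n V \<Longrightarrow> finite V"
  using finite_subset[OF vsubspace_subset finite_carrier_vec_bit] .

text \<open>Coefficient functions on a basis correspond bijectively to the vectors of V, and each
  basis element has two possible coefficients. From here on dimensions are handled as cardinalities,
  which is the form that the counting arguments consume.\<close>

lemma card_vsubspace:
  assumes "vsubspace n V"
  shows "card V = 2 ^ vdim n V"
proof -
  interpret S: vec_space "TYPE(bit)" n .
  let ?V = "module_vec TYPE(bit) n\<lparr>carrier := V\<rparr>"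
  interpret W: vectorspace class_ring ?V
    by (rule S.subspace_is_vs[OF assms[unfolded vsubspace_def]])
  \<comment> \<open>The witness is V itself, a finite spanning set.\<close>
  have "W.fin_dim"
    unfolding W.fin_dim_def
    using finite_vsubspace[OF assms] W.in_own_span[of V] W.span_is_subset2[of V]
    by (intro exI[of _ V]) auto
  then obtain B where B: "finite B" "W.basis B"
    using W.finite_basis_exists by blast
  have BV: "B \<subseteq> V" using B(2) by (simp add: W.basis_def)
  have ex1: "\<And>v. v \<in> V \<Longrightarrow> \<exists>!a. a \<in> B \<rightarrow>\<^sub>E UNIV \<and> W.lincomb a B = v"
    using W.basis_criterion[OF B(1)] B(2) BV by simp
  have closed: "W.lincomb a B \<in> V" for a
    using W.lincomb_closed[of B a] BV by simp
  have "bij_betw (\<lambda>a. W.lincomb a B) (B \<rightarrow>\<^sub>E UNIV) V"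
    unfolding bij_betw_def
  proof
    show "inj_on (\<lambda>a. W.lincomb a B) (B \<rightarrow>\<^sub>E UNIV)"
    proof (rule inj_onI)
      fix a b
      assume "a \<in> B \<rightarrow>\<^sub>E UNIV" "b \<in> B \<rightarrow>\<^sub>E UNIV" "W.lincomb a B = W.lincomb b B"
      then show "a = b" using ex1[OF closed[of b]] by blast
    qed
    show "(\<lambda>a. W.lincomb a B) ` (B \<rightarrow>\<^sub>E UNIV) = V"
    proof (intro equalityI image_subsetI subsetI)
      fix v assume "v \<in> V"
      then obtain a where "a \<in> B \<rightarrow>\<^sub>E UNIV" "W.lincomb a B = v" using ex1 by blast
      then show "v \<in> (\<lambda>a. W.lincomb a B) ` (B \<rightarrow>\<^sub>E UNIV)" by blast
    qed (rule closed)
  qed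
  then have "card V = card (B \<rightarrow>\<^sub>E (UNIV :: bit set))"
    by (simp add: bij_betw_same_card)
  also have "\<dots> = 2 ^ card B" using B(1) by (simp add: card_PiE card_UNIV_bit)
  finally show ?thesis
    unfolding vdim_def using W.dim_basis[OF B] by simp
qed

lemma vdim_eq_iff: "vsubspace n V \<Longrightarrow> vdim n V = k \<longleftrightarrow> card V = 2 ^ k"
  by (simp add: card_vsubspace)

lemma grassmann_iff: "V \<in> grassmann l n \<longleftrightarrow> vsubspace n V \<and> card V = 2 ^ l"
  unfolding grassmann_def mem_Collect_eq using vdim_eq_iff by blast

lemma vsubspace_Int: "vsubspace n U \<Longrightarrow> vsubspace n V \<Longrightarrow> vsubspace n (U \<inter> V)"
  by (auto simp: vsubspace_iff)

text \<open>Codimension one means filling half of the space. Doubling the intersection keeps the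
  equation free of subtraction; for \<open>l = 0\<close> both sides fail.\<close>

lemma grassmann_edges_iff:
  "(V, V') \<in> grassmann_edges l n \<longleftrightarrow>
     V \<in> grassmann l n \<and> V' \<in> grassmann l n \<and> 2 * card (V \<inter> V') = 2 ^ l"
proof -
  have "vdim n (V \<inter> V') + 1 = l \<longleftrightarrow> 2 * card (V \<inter> V') = 2 ^ l"
    if "V \<in> grassmann l n" "V' \<in> grassmann l n"
  proof -
    have "card (V \<inter> V') = 2 ^ vdim n (V \<inter> V')"
      using that by (intro card_vsubspace vsubspace_Int) (auto simp: grassmann_iff)
    then have "2 * card (V \<inter> V') = 2 ^ (vdim n (V \<inter> V') + 1)" by simp
    then show ?thesis by (simp only: power_inject_exp)
  qed
  then show ?thesis by (auto simp: grassmann_edges_def)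
qed

lemma finite_grassmann: "finite (grassmann l n)"
  by (rule finite_subset[of _ "Pow (carrier_vec n)"]) (auto simp: grassmann_iff vsubspace_iff)

lemma finite_grassmann_edges: "finite (grassmann_edges l n)"
  by (rule finite_subset[of _ "grassmann l n \<times> grassmann l n"])
    (auto simp: grassmann_edges_def finite_grassmann)

section \<open>Adjoining one vector to a subspace\<close>

text \<open>For a subspace U this is the span of x and U: over F_2 it consists of the two cosets U
  and x + U only.\<close>

definition adjoin :: "bit vec \<Rightarrow> bit vec set \<Rightarrow> bit vec set" where
  "adjoin x U = U \<union> (+) x ` U"

lemma adjoin_cases:
  assumes "v \<in> adjoin x U"
  obtains "v \<in> U" | u where "u \<in> U" "v = x + u"
  using assms by (auto simp: adjoin_def)

lemma vsubspace_adjoin: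
  assumes U: "vsubspace n U" and x: "x \<in> carrier_vec n"
  shows "vsubspace n (adjoin x U)"
proof (rule vsubspaceI)
  show "adjoin x U \<subseteq> carrier_vec n"
    using vsubspace_carrier[OF U] x by (auto simp: adjoin_def)
  show "0\<^sub>v n \<in> adjoin x U" using vsubspace_zero[OF U] by (simp add: adjoin_def)
next
  fix v w
  assume vw: "v \<in> adjoin x U" "w \<in> adjoin x U"
  note c = vsubspace_carrier[OF U] and a = vsubspace_add[OF U]
  from vw(1) show "v + w \<in> adjoin x U"
  proof (cases rule: adjoin_cases)
    case 1
    from vw(2) show ?thesis
    proof (cases rule: adjoin_cases)
      case (2 u)
      have "v + w = x + (v + u)"
        using c[OF 1] c[OF 2(1)] x unfolding 2(2)
        by (metis assoc_add_vec comm_add_vec)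
      then show ?thesis using a[OF 1 2(1)] by (auto simp: adjoin_def)
    qed (use 1 a in \<open>auto simp: adjoin_def\<close>)
  next
    case v: (2 u)
    from vw(2) show ?thesis
    proof (cases rule: adjoin_cases)
      case 1
      have "v + w = x + (u + w)"
        using c[OF 1] c[OF v(1)] x unfolding v(2) by simp
      then show ?thesis using a[OF v(1) 1] by (auto simp: adjoin_def)
    next
      case (2 u')
      \<comment> \<open>Both summands lie in x + U, and the two copies of x cancel in characteristic
        2.\<close>
      have "v + w = u + u'"
      proof -
        have "v + w = (u + x) + (x + u')"
          using comm_add_vec[OF x c[OF v(1)]] by (simp add: v(2) 2(2))
        also have "\<dots> = u + (x + (x + u'))"
          using c[OF v(1)] c[OF 2(1)] x by (intro assoc_add_vec) auto
        finally show ?thesis using c[OF 2(1)] x by (simp add: bit_vec_add_cancel)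
      qed
      then show ?thesis using a[OF v(1) 2(1)] by (auto simp: adjoin_def)
    qed
  qed
qed

lemma add_notin_vsubspace:
  assumes "vsubspace n U" "x \<in> carrier_vec n" "x \<notin> U" "u \<in> U"
  shows "x + u \<notin> U"
proof
  assume "x + u \<in> U"
  then have "(x + u) + u \<in> U" using assms by (blast intro: vsubspace_add)
  moreover have "(x + u) + u = x"
    using assms vsubspace_carrier[OF assms(1,4)] by (simp add: bit_vec_add_self)
  ultimately show False using assms by simp
qed

lemma card_adjoin:
  assumes "vsubspace n U" "x \<in> carrier_vec n" "x \<notin> U"
  shows "card (adjoin x U) = 2 * card U"
proof -
  have "inj_on ((+) x) U"
    using bit_vec_add_cancel[OF assms(2) vsubspace_carrier[OF assms(1)]]
    by (intro inj_on_inverseI[where g = "(+) x"])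
  then have "card ((+) x ` U) = card U" by (rule card_image)
  moreover have "U \<inter> (+) x ` U = {}" using add_notin_vsubspace[OF assms] by auto
  ultimately show ?thesis
    using finite_vsubspace[OF assms(1)] by (simp add: adjoin_def card_Un_disjoint)
qed

lemma adjoin_subset:
  assumes "vsubspace n V" "U \<subseteq> V" "x \<in> V"
  shows "adjoin x U \<subseteq> V"
  using assms by (auto simp: adjoin_def intro: vsubspace_add)

section \<open>Transitivity of linear automorphisms on Grassmann edges\<close>

text \<open>Additivity is full linearity over F_2. The values of g outside U are left free, so that
  isomorphisms can be extended step by step.\<close>

definition vs_iso :: "nat \<Rightarrow> bit vec set \<Rightarrow> bit vec set \<Rightarrow> (bit vec \<Rightarrow> bit vec) \<Rightarrow> bool" where
  "vs_iso n U U' g \<longleftrightarrow> vsubspace n U \<and> vsubspace n U' \<and> bij_betw g U U' \<and>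
     (\<forall>x\<in>U. \<forall>y\<in>U. g (x + y) = g x + g y)"

lemma vs_isoD:
  assumes "vs_iso n U U' g"
  shows "vsubspace n U" "vsubspace n U'" "inj_on g U" "g ` U = U'"
    "\<And>x. x \<in> U \<Longrightarrow> g x \<in> U'" "\<And>x y. x \<in> U \<Longrightarrow> y \<in> U \<Longrightarrow> g (x + y) = g x + g y"
  using assms by (auto simp: vs_iso_def bij_betw_def)

lemma vs_iso_zero:
  assumes "vs_iso n U U' g"
  shows "g (0\<^sub>v n) = 0\<^sub>v n"
proof -
  note g = vs_isoD[OF assms]
  have z: "0\<^sub>v n \<in> U" using vsubspace_zero[OF g(1)] .
  have c: "g (0\<^sub>v n) \<in> carrier_vec n" using vsubspace_carrier[OF g(2)] g(5)[OF z] .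
  have "g (0\<^sub>v n) = g (0\<^sub>v n) + g (0\<^sub>v n)" using g(6)[OF z z] by simp
  then show ?thesis using bit_vec_add_self[OF c] by simp
qed

lemma vs_iso_image:
  assumes "vs_iso n U U' g" "vsubspace n V" "V \<subseteq> U"
  shows "vsubspace n (g ` V)" "card (g ` V) = card V"
proof -
  note g = vs_isoD[OF assms(1)]
  show "vsubspace n (g ` V)"
  proof (rule vsubspaceI)
    show "g ` V \<subseteq> carrier_vec n" using g(5) assms(3) vsubspace_subset[OF g(2)] by blast
    show "0\<^sub>v n \<in> g ` V"
      using vs_iso_zero[OF assms(1)] vsubspace_zero[OF assms(2)] by (metis image_eqI)
  next
    fix x y assume "x \<in> g ` V" "y \<in> g ` V"
    then obtain a b where ab: "a \<in> V" "b \<in> V" "x = g a" "y = g b" by auto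
    then have "x + y = g (a + b)" using g(6) assms(3) by (simp add: subset_iff)
    then show "x + y \<in> g ` V" using vsubspace_add[OF assms(2)] ab by blast
  qed
  show "card (g ` V) = card V"
    using inj_on_subset[OF g(3) assms(3)] by (rule card_image)
qed

text \<open>The coset x + U is sent to y + U' by \<open>x + u \<mapsto> y + g u\<close>.\<close>

lemma vs_iso_adjoin:
  assumes g: "vs_iso n U U' g"
    and x: "x \<in> carrier_vec n" "x \<notin> U" and y: "y \<in> carrier_vec n" "y \<notin> U'"
  obtains h where "vs_iso n (adjoin x U) (adjoin y U') h" "\<And>u. u \<in> U \<Longrightarrow> h u = g u" "h x = y"
proof -
  note gD = vs_isoD[OF g]
  \<comment> \<open>On the coset, \<open>x + v\<close> recovers the component u of
    \<open>v = x + u\<close>.\<close>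
  define h where "h v = (if v \<in> U then g v else y + g (x + v))" for v
  have h1: "h u = g u" if "u \<in> U" for u using that by (simp add: h_def)
  have h2: "h (x + u) = y + g u" if "u \<in> U" for u
    using that add_notin_vsubspace[OF gD(1) x that]
      bit_vec_add_cancel[OF x(1) vsubspace_carrier[OF gD(1) that]] by (simp add: h_def)
  note cU = vsubspace_carrier[OF gD(1)] and cU' = vsubspace_carrier[OF gD(2) gD(5)]
  have im: "h ` adjoin x U = adjoin y U'"
  proof -
    have "h ` adjoin x U = h ` U \<union> (\<lambda>u. h (x + u)) ` U"
      by (simp add: adjoin_def image_Un image_image)
    also have "h ` U = U'" using h1 gD(4) by auto
    also have "(\<lambda>u. h (x + u)) ` U = (+) y ` g ` U" using h2 by (auto simp: image_image)
    finally show ?thesis using gD(4) by (simp add: adjoin_def)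
  qed
  have sub: "vsubspace n (adjoin x U)" "vsubspace n (adjoin y U')"
    using vsubspace_adjoin gD x y by blast+
  \<comment> \<open>Injectivity by counting: the image is as large as the finite domain.\<close>
  have "card (h ` adjoin x U) = card (adjoin x U)"
    using card_adjoin[OF gD(1) x] card_adjoin[OF gD(2) y] card_image[OF gD(3)] im gD(4) by simp
  then have inj: "inj_on h (adjoin x U)"
    using finite_vsubspace[OF sub(1)] by (rule eq_card_imp_inj_on[rotated])
  \<comment> \<open>These coset sums occur in the domain with x and again in the codomain with
    y.\<close>
  have sum_mixed: "(x + u) + w = x + (u + w)" "w + (x + u) = x + (w + u)"
    "(x + u) + (x + w) = u + w" if "x \<in> carrier_vec n" "u \<in> carrier_vec n" "w \<in> carrier_vec n"
    for x u w :: "bit vec"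
  proof -
    show 1: "(x + u) + w = x + (u + w)" using that by simp
    show "w + (x + u) = x + (w + u)"
      using that 1 comm_add_vec[of w n "x + u"] comm_add_vec[of w n u] by simp
    have "(x + u) + (x + w) = u + (x + (x + w))"
      using that comm_add_vec[of x n u] by simp
    then show "(x + u) + (x + w) = u + w" using that by (simp add: bit_vec_add_cancel)
  qed
  have add: "h (v + w) = h v + h w" if v: "v \<in> adjoin x U" and w: "w \<in> adjoin x U" for v w
    using v
  proof (cases rule: adjoin_cases)
    case v: 1
    from w show ?thesis
    proof (cases rule: adjoin_cases)
      case 1
      then show ?thesis using v gD(6) vsubspace_add[OF gD(1)] by (simp add: h1)
    next
      case (2 u)
      then show ?thesis using v vsubspace_add[OF gD(1) v 2(1)] gD(6)[OF v 2(1)]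
        by (simp add: sum_mixed(2)[OF x(1) cU cU] h1 h2 sum_mixed(2)[OF y(1) cU' cU'])
    qed
  next
    case v: (2 u)
    from w show ?thesis
    proof (cases rule: adjoin_cases)
      case 1
      then show ?thesis using v vsubspace_add[OF gD(1) v(1) 1] gD(6)[OF v(1) 1]
        by (simp add: sum_mixed(1)[OF x(1) cU cU] h1 h2 sum_mixed(1)[OF y(1) cU' cU'])
    next
      case (2 u')
      then show ?thesis using v vsubspace_add[OF gD(1) v(1) 2(1)] gD(6)[OF v(1) 2(1)]
        by (simp add: sum_mixed(3)[OF x(1) cU cU] h1 h2 sum_mixed(3)[OF y(1) cU' cU'])
    qed
  qed
  have "x + 0\<^sub>v n = x" "y + 0\<^sub>v n = y" using x y by auto
  then have "h x = y" using h2[OF vsubspace_zero[OF gD(1)]] vs_iso_zero[OF g] by simp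
  moreover have "vs_iso n (adjoin x U) (adjoin y U') h"
    using sub inj im add by (simp add: vs_iso_def bij_betw_def)
  ultimately show ?thesis using that h1 by blast
qed

text \<open>One vector is adjoined on each side until T is filled. Since U and U' always have equal
  size, as do T and T', both sides are exhausted at the same moment.\<close>

lemma vs_iso_extend:
  assumes "vs_iso n U U' g" "vsubspace n T" "vsubspace n T'" "U \<subseteq> T" "U' \<subseteq> T'" "card T = card T'"
  shows "\<exists>h. vs_iso n T T' h \<and> (\<forall>u\<in>U. h u = g u)"
  using assms
proof (induction "card T - card U" arbitrary: U U' g rule: less_induct)
  case less
  note g = vs_isoD[OF less.prems(1)]
  note fin = finite_vsubspace[OF less.prems(2)] finite_vsubspace[OF less.prems(3)]
  have card: "card U' = card U" using card_image[OF g(3)] g(4) by simp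
  show ?case
  proof (cases "U = T")
    case True
    then have "U' = T'" using card less.prems fin by (intro card_subset_eq) auto
    then show ?thesis using True less.prems by blast
  next
    case False
    then obtain x where x: "x \<in> T" "x \<notin> U" using less.prems by blast
    have "card U < card T" using False fin less.prems by (intro psubset_card_mono) auto
    then have "U' \<noteq> T'" using card less.prems by auto
    then obtain y where y: "y \<in> T'" "y \<notin> U'" using less.prems by blast
    note c = vsubspace_carrier[OF less.prems(2) x(1)] vsubspace_carrier[OF less.prems(3) y(1)]
    obtain h where h: "vs_iso n (adjoin x U) (adjoin y U') h" "\<And>u. u \<in> U \<Longrightarrow> h u = g u"
      using vs_iso_adjoin[OF less.prems(1) c(1) x(2) c(2) y(2)] by metis
    have sub: "adjoin x U \<subseteq> T" "adjoin y U' \<subseteq> T'"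
      using adjoin_subset less.prems x y by metis+
    have "0 < card U" using vsubspace_zero[OF g(1)] finite_vsubspace[OF g(1)] by (auto simp: card_gt_0_iff)
    then have "card T - card (adjoin x U) < card T - card U"
      using card_adjoin[OF g(1) c(1) x(2)] \<open>card U < card T\<close> by simp
    from less.hyps[OF this h(1) less.prems(2,3) sub less.prems(6)]
    obtain k where k: "vs_iso n T T' k" "\<forall>u\<in>adjoin x U. k u = h u" by blast
    then have "\<forall>u\<in>U. k u = g u" using h(2) by (simp add: adjoin_def)
    then show ?thesis using k(1) by blast
  qed
qed

section \<open>The general linear group and its action on edges\<close>

text \<open>This is GL_n over F_2 as a set of functions. Extensionality gives each automorphism a
  single representative, which makes the set finite and its cardinality meaningful.\<close>

definition vs_aut :: "nat \<Rightarrow> (bit vec \<Rightarrow> bit vec) set" where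
  "vs_aut n = {g \<in> extensional (carrier_vec n). vs_iso n (carrier_vec n) (carrier_vec n) g}"

lemma finite_vs_aut: "finite (vs_aut n)"
proof (rule finite_subset)
  show "vs_aut n \<subseteq> carrier_vec n \<rightarrow>\<^sub>E carrier_vec n"
  proof
    fix g assume "g \<in> vs_aut n"
    then show "g \<in> carrier_vec n \<rightarrow>\<^sub>E carrier_vec n"
      using vs_isoD(5)[of n _ _ g] by (auto simp: vs_aut_def PiE_def)
  qed
qed (simp add: finite_PiE)

lemma vsubspace_carrier_vec: "vsubspace n (carrier_vec n)"
  by (auto simp: vsubspace_iff)

lemma vs_iso_cong:
  assumes "vs_iso n U U' g" "\<And>u. u \<in> U \<Longrightarrow> h u = g u"
  shows "vs_iso n U U' h"
proof -
  have "bij_betw h U U'" using assms bij_betw_cong[of U h g U'] by (simp add: vs_iso_def)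
  then show ?thesis using assms vsubspace_add[of n U] by (simp add: vs_iso_def)
qed

lemma restrict_vs_aut:
  "vs_iso n (carrier_vec n) (carrier_vec n) g \<Longrightarrow> restrict g (carrier_vec n) \<in> vs_aut n"
  using vs_iso_cong[of n _ _ g "restrict g (carrier_vec n)"] by (simp add: vs_aut_def)

lemma vs_iso_comp:
  assumes "vs_iso n U U' g" "vs_iso n U' U'' h"
  shows "vs_iso n U U'' (h \<circ> g)"
  using assms vs_isoD(5)[OF assms(1)] bij_betw_trans[of g U U' h U'']
  by (simp add: vs_iso_def)

lemma vs_iso_id: "vsubspace n U \<Longrightarrow> vs_iso n U U (\<lambda>x. x)"
  by (simp add: vs_iso_def bij_betw_def)

lemma vs_aut_nonempty: "vs_aut n \<noteq> {}"
  using restrict_vs_aut[OF vs_iso_id[OF vsubspace_carrier_vec]] by blast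

lemma vs_autD: "g \<in> vs_aut n \<Longrightarrow> vs_iso n (carrier_vec n) (carrier_vec n) g"
  by (simp add: vs_aut_def)

lemma vsubspace_adjoin_half:
  assumes "vsubspace n V" "vsubspace n U" "U \<subseteq> V" "card V = 2 * card U"
  obtains v where "v \<in> V" "v \<notin> U" "v \<in> carrier_vec n" "V = adjoin v U"
proof -
  have "0 < card U"
    using vsubspace_zero[OF assms(2)] finite_vsubspace[OF assms(2)] by (auto simp: card_gt_0_iff)
  then have "U \<noteq> V" using assms by auto
  then obtain v where v: "v \<in> V" "v \<notin> U" using assms by blast
  have c: "v \<in> carrier_vec n" using vsubspace_carrier[OF assms(1) v(1)] .
  have "adjoin v U = V"
    using card_adjoin[OF assms(2) c v(2)] adjoin_subset[OF assms(1,3) v(1)] assms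
    by (intro card_subset_eq finite_vsubspace[OF assms(1)]) auto
  then show ?thesis using that v c by blast
qed

definition map_edge :: "(bit vec \<Rightarrow> bit vec) \<Rightarrow> bit vec set \<times> bit vec set \<Rightarrow> bit vec set \<times> bit vec set"
  where "map_edge g e = (g ` fst e, g ` snd e)"

lemma grassmann_vs_aut:
  assumes "g \<in> vs_aut n" "V \<in> grassmann l n"
  shows "g ` V \<in> grassmann l n"
  using assms vs_iso_image[OF vs_autD[OF assms(1)], of V] by (auto simp: grassmann_iff vsubspace_iff)

lemma map_edge_in_grassmann_edges:
  assumes "g \<in> vs_aut n" "e \<in> grassmann_edges l n"
  shows "map_edge g e \<in> grassmann_edges l n"
proof -
  obtain V V' where e: "e = (V, V')" by (cases e)
  with assms have V: "V \<in> grassmann l n" "V' \<in> grassmann l n" "2 * card (V \<inter> V') = 2 ^ l"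
    by (auto simp: grassmann_edges_iff)
  then have s: "vsubspace n V" "vsubspace n V'" by (auto simp: grassmann_iff)
  note iso = vs_autD[OF assms(1)]
  have "g ` (V \<inter> V') = g ` V \<inter> g ` V'"
    using inj_on_image_Int[OF vs_isoD(3)[OF iso]] s by (auto simp: vsubspace_iff)
  moreover have "card (g ` (V \<inter> V')) = card (V \<inter> V')"
    using s by (intro vs_iso_image[OF iso] vsubspace_Int) (auto simp: vsubspace_iff)
  ultimately show ?thesis
    using V grassmann_vs_aut[OF assms(1)] by (simp add: map_edge_def e grassmann_edges_iff)
qed

text \<open>The automorphism is built along the chain \<open>V1 \<inter> W1\<close>, V1, V1 + W1,
  F_2^n, each stage extending the previous one. W1 is carried along because it is the intersection
  together with one further coset.\<close>

lemma grassmann_edges_transitive: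
  assumes "e \<in> grassmann_edges l n" "e' \<in> grassmann_edges l n"
  obtains g where "g \<in> vs_aut n" "map_edge g e = e'"
proof -
  obtain V1 W1 V2 W2 where e: "e = (V1, W1)" "e' = (V2, W2)" by (cases e; cases e')
  let ?U1 = "V1 \<inter> W1" and ?U2 = "V2 \<inter> W2"
  have s: "vsubspace n V1" "vsubspace n W1" "vsubspace n V2" "vsubspace n W2"
    and cards: "card V1 = 2 ^ l" "card W1 = 2 ^ l" "card V2 = 2 ^ l" "card W2 = 2 ^ l"
      "2 * card ?U1 = 2 ^ l" "2 * card ?U2 = 2 ^ l"
    using assms by (auto simp: e grassmann_edges_iff grassmann_iff)
  have U: "vsubspace n ?U1" "vsubspace n ?U2" using s by (auto intro: vsubspace_Int)
  have Z: "vsubspace n {0\<^sub>v n}" by (rule vsubspaceI) auto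
  \<comment> \<open>The extension starts from the identity of the zero space.\<close>
  obtain g where g: "vs_iso n ?U1 ?U2 g"
    using vs_iso_extend[OF vs_iso_id[OF Z] U] vsubspace_zero[OF U(1)] vsubspace_zero[OF U(2)] cards
    by auto
  obtain h where h: "vs_iso n V1 V2 h" "\<forall>u\<in>?U1. h u = g u"
    using vs_iso_extend[OF g s(1,3)] cards by auto
  obtain w1 where w1: "w1 \<in> W1" "w1 \<notin> ?U1" "w1 \<in> carrier_vec n" "W1 = adjoin w1 ?U1"
    using vsubspace_adjoin_half[OF s(2) U(1)] cards by auto
  obtain w2 where w2: "w2 \<in> W2" "w2 \<notin> ?U2" "w2 \<in> carrier_vec n" "W2 = adjoin w2 ?U2"
    using vsubspace_adjoin_half[OF s(4) U(2)] cards by auto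
  \<comment> \<open>As w1 lies outside V1 and w2 outside V2, w1 can be sent to w2 without affecting
    the map on V1.\<close>
  have "w1 \<notin> V1" "w2 \<notin> V2" using w1 w2 by auto
  with vs_iso_adjoin[OF h(1) w1(3) _ w2(3)] obtain k where
    k: "vs_iso n (adjoin w1 V1) (adjoin w2 V2) k" "\<And>u. u \<in> V1 \<Longrightarrow> k u = h u" "k w1 = w2"
    by metis
  have "vsubspace n (adjoin w1 V1)" "vsubspace n (adjoin w2 V2)"
    using vs_isoD[OF k(1)] by auto
  then have "adjoin w1 V1 \<subseteq> carrier_vec n" "adjoin w2 V2 \<subseteq> carrier_vec n"
    by (auto dest: vsubspace_subset)
  from vs_iso_extend[OF k(1) vsubspace_carrier_vec vsubspace_carrier_vec this]
  obtain f where f: "vs_iso n (carrier_vec n) (carrier_vec n) f" "\<forall>u\<in>adjoin w1 V1. f u = k u"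
    by auto
  have fV: "f ` V1 = V2"
    using vs_isoD(4)[OF h(1)] f(2) k(2) by (auto simp: adjoin_def)
  have fU: "f ` ?U1 = ?U2"
    using vs_isoD(4)[OF g] f(2) k(2) h(2) by (auto simp: adjoin_def)
  have "f w1 = w2"
  proof -
    have "w1 \<in> adjoin w1 V1"
      using w1(1,4) unfolding adjoin_def by blast
    then show ?thesis using f(2) k(3) by simp
  qed
  then have "f (w1 + u) = w2 + f u" if "u \<in> ?U1" for u
    using vs_isoD(6)[OF f(1) w1(3)] vsubspace_carrier[OF U(1) that] by simp
  then have "f ` (+) w1 ` ?U1 = (+) w2 ` f ` ?U1" by (force simp: image_image)
  then have fW: "f ` W1 = W2"
    using fU w1(4) w2(4) unfolding adjoin_def by (metis image_Un)
  define f' where "f' = restrict f (carrier_vec n)"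
  have "f' \<in> vs_aut n" unfolding f'_def by (rule restrict_vs_aut[OF f(1)])
  moreover have "f' ` V1 = f ` V1" "f' ` W1 = f ` W1"
    unfolding f'_def using vsubspace_subset[OF s(1)] vsubspace_subset[OF s(2)]
    by (intro image_cong refl; simp add: subset_iff)+
  then have "map_edge f' e = e'"
    using fV fW
    by (simp add: map_edge_def e)
  ultimately show ?thesis by (rule that)
qed

text \<open>Composing on the left with an automorphism that takes e1 to e2 is injective. By
  symmetry, the automorphisms taking e to a given edge are equally many for every target.\<close>

lemma vs_aut_transporters_le:
  assumes e: "e \<in> grassmann_edges l n" "e1 \<in> grassmann_edges l n" "e2 \<in> grassmann_edges l n"
  shows "card {g \<in> vs_aut n. map_edge g e = e1} \<le> card {g \<in> vs_aut n. map_edge g e = e2}"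
proof -
  obtain k where k: "k \<in> vs_aut n" "map_edge k e1 = e2"
    using grassmann_edges_transitive[OF e(2,3)] .
  note kD = vs_isoD[OF vs_autD[OF k(1)]]
  have sub: "fst e \<subseteq> carrier_vec n" "snd e \<subseteq> carrier_vec n"
    using e(1) by (auto simp: grassmann_edges_def grassmann_def vsubspace_iff)
  show ?thesis
  proof (rule card_inj_on_le[where f = "\<lambda>g. restrict (k \<circ> g) (carrier_vec n)"])
    show "inj_on (\<lambda>g. restrict (k \<circ> g) (carrier_vec n)) {g \<in> vs_aut n. map_edge g e = e1}"
    proof (rule inj_onI, clarify)
      fix g h
      assume gh: "g \<in> vs_aut n" "h \<in> vs_aut n"
        and eq: "restrict (k \<circ> g) (carrier_vec n) = restrict (k \<circ> h) (carrier_vec n)"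
      note gD = vs_isoD[OF vs_autD[OF gh(1)]] and hD = vs_isoD[OF vs_autD[OF gh(2)]]
      show "g = h"
      proof (rule extensionalityI)
        fix x :: "bit vec" assume x: "x \<in> carrier_vec n"
        then have "k (g x) = k (h x)" using fun_cong[OF eq, of x] by simp
        then show "g x = h x" using inj_onD[OF kD(3)] gD(5)[OF x] hD(5)[OF x] by blast
      qed (use gh in \<open>auto simp: vs_aut_def\<close>)
    qed
    show "(\<lambda>g. restrict (k \<circ> g) (carrier_vec n)) ` {g \<in> vs_aut n. map_edge g e = e1}
      \<subseteq> {g \<in> vs_aut n. map_edge g e = e2}"
    proof safe
      fix g assume g: "g \<in> vs_aut n" "e1 = map_edge g e"
      show "restrict (k \<circ> g) (carrier_vec n) \<in> vs_aut n"
        using restrict_vs_aut[OF vs_iso_comp[OF vs_autD[OF g(1)] vs_autD[OF k(1)]]] .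
      have "restrict (k \<circ> g) (carrier_vec n) ` A = k ` g ` A" if "A \<subseteq> carrier_vec n" for A
        using that by (auto simp: image_image subset_iff intro!: image_cong)
      then show "map_edge (restrict (k \<circ> g) (carrier_vec n)) e = e2"
        using sub k(2) g(2) by (simp add: map_edge_def)
    qed
  qed (simp add: finite_vs_aut)
qed

text \<open>A uniformly random automorphism sends a fixed edge to a uniformly random edge, so it
  hits C with probability equal to the density of C. The identity says this with denominators
  cleared.\<close>

lemma card_vs_aut_hitting:
  assumes e: "e \<in> grassmann_edges l n" and C: "C \<subseteq> grassmann_edges l n"
  shows "card {g \<in> vs_aut n. map_edge g e \<in> C} * card (grassmann_edges l n) = card C * card (vs_aut n)"
proof -
  define c where "c = card {g \<in> vs_aut n. map_edge g e = e}"
  have c: "card {g \<in> vs_aut n. map_edge g e = e'} = c" if "e' \<in> grassmann_edges l n" for e'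
    unfolding c_def using vs_aut_transporters_le[OF e] e that by (intro antisym) auto
  have *: "card {g \<in> vs_aut n. map_edge g e \<in> D} = card D * c" if D: "D \<subseteq> grassmann_edges l n" for D
  proof -
    have "{g \<in> vs_aut n. map_edge g e \<in> D} = (\<Union>d\<in>D. {g \<in> vs_aut n. map_edge g e = d})" by auto
    also have "card \<dots> = (\<Sum>d\<in>D. card {g \<in> vs_aut n. map_edge g e = d})"
      using D finite_subset[OF D finite_grassmann_edges] finite_vs_aut
      by (intro card_UN_disjoint) auto
    also have "\<dots> = (\<Sum>d\<in>D. c)" using c D by (intro sum.cong) auto
    also have "\<dots> = card D * c" by simp
    finally show ?thesis .
  qed
  have "{g \<in> vs_aut n. map_edge g e \<in> grassmann_edges l n} = vs_aut n"
    using map_edge_in_grassmann_edges[OF _ e] by auto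
  then have "card (vs_aut n) = card (grassmann_edges l n) * c" using *[of "grassmann_edges l n"] by simp
  then show ?thesis using *[OF C] by simp
qed

text \<open>Pairs \<open>(g, t)\<close> whose transported edge lies in C are counted in two ways.
  For each t the proportion of suitable g is the density of C, hence some g does at least as well on
  T. Later T is a set of test triples and C the set of consistent edges.\<close>

lemma edge_averaging:
  assumes T: "finite T" "\<And>t. t \<in> T \<Longrightarrow> e t \<in> grassmann_edges l n" and C: "C \<subseteq> grassmann_edges l n"
  obtains g where "g \<in> vs_aut n"
    "card C * card T \<le> card {t \<in> T. map_edge g (e t) \<in> C} * card (grassmann_edges l n)"
proof -
  let ?E = "card (grassmann_edges l n)" and ?P = "\<lambda>g t. map_edge g (e t) \<in> C"
  have "(\<Sum>g\<in>vs_aut n. card {t \<in> T. ?P g t}) = (\<Sum>t\<in>T. card {g \<in> vs_aut n. ?P g t})"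
    using sum.swap[of "\<lambda>g t. of_bool (?P g t) :: nat" T "vs_aut n"]
    by (simp add: T(1) finite_vs_aut Int_def)
  then have "(\<Sum>g\<in>vs_aut n. card {t \<in> T. ?P g t} * ?E) = (\<Sum>t\<in>T. card {g \<in> vs_aut n. ?P g t} * ?E)"
    by (simp flip: sum_distrib_right)
  also have "\<dots> = (\<Sum>t\<in>T. card C * card (vs_aut n))"
    using card_vs_aut_hitting[OF T(2) C] by (intro sum.cong) auto
  also have "\<dots> = (\<Sum>g\<in>vs_aut n. card C * card T)" by (simp add: ac_simps)
  finally have sums: "(\<Sum>g\<in>vs_aut n. card {t \<in> T. ?P g t} * ?E) = (\<Sum>g\<in>vs_aut n. card C * card T)" .
  have "\<exists>g\<in>vs_aut n. card C * card T \<le> card {t \<in> T. ?P g t} * ?E"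
  proof (rule ccontr)
    assume "\<not> ?thesis"
    then have "(\<Sum>g\<in>vs_aut n. card {t \<in> T. ?P g t} * ?E) < (\<Sum>g\<in>vs_aut n. card C * card T)"
      by (intro sum_strict_mono finite_vs_aut vs_aut_nonempty) (auto simp: not_le)
    with sums show False by simp
  qed
  then show ?thesis using that by blast
qed

section \<open>Counting subspaces and matrices\<close>

text \<open>Linear independence modulo U, built from the end of the list, with
  \<open>foldr adjoin xs U\<close> as the span of U and xs. In this order each new vector only has
  to avoid a span of known size.\<close>

primrec indep_over :: "bit vec set \<Rightarrow> bit vec list \<Rightarrow> bool" where
  "indep_over U [] \<longleftrightarrow> True"
| "indep_over U (x # xs) \<longleftrightarrow> indep_over U xs \<and> x \<notin> foldr adjoin xs U"

lemma vsubspace_foldr_adjoin: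
  "vsubspace n U \<Longrightarrow> set xs \<subseteq> carrier_vec n \<Longrightarrow> vsubspace n (foldr adjoin xs U)"
  by (induction xs) (auto intro: vsubspace_adjoin)

lemma card_foldr_adjoin:
  "vsubspace n U \<Longrightarrow> set xs \<subseteq> carrier_vec n \<Longrightarrow> indep_over U xs \<Longrightarrow>
     card (foldr adjoin xs U) = 2 ^ length xs * card U"
  by (induction xs) (simp_all add: card_adjoin[of n] vsubspace_foldr_adjoin)

lemma subset_adjoin: "U \<subseteq> adjoin x U"
  by (simp add: adjoin_def)

lemma mem_adjoin: "vsubspace n U \<Longrightarrow> x \<in> carrier_vec n \<Longrightarrow> x \<in> adjoin x U"
  using vsubspace_zero[of n U] unfolding adjoin_def by (metis UnCI image_eqI right_zero_vec)

lemma foldr_adjoin_subset: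
  "vsubspace n V \<Longrightarrow> U \<subseteq> V \<Longrightarrow> set xs \<subseteq> V \<Longrightarrow> foldr adjoin xs U \<subseteq> V"
  by (induction xs) (simp_all add: adjoin_subset)

lemma vsubspace_trivial: "vsubspace n {0\<^sub>v n}"
  by (rule vsubspaceI) auto

text \<open>The vectors in ps may be dependent, whereas Q and W will need exact dimensions. For a
  vector that is already in the span, an arbitrary vector outside it is added instead; one exists
  because the span has fewer than \<open>2 ^ n\<close> elements.\<close>

lemma indep_list_spanning:
  assumes "set ps \<subseteq> carrier_vec n" "length ps \<le> n"
  shows "\<exists>bs. length bs = length ps \<and> set bs \<subseteq> carrier_vec n \<and> indep_over {0\<^sub>v n} bs \<and>
    set ps \<subseteq> foldr adjoin bs {0\<^sub>v n}"
  using assms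
proof (induction ps)
  case (Cons p ps)
  then obtain bs where bs: "length bs = length ps" "set bs \<subseteq> carrier_vec n"
    "indep_over {0\<^sub>v n} bs" "set ps \<subseteq> foldr adjoin bs {0\<^sub>v n}" by auto
  let ?S = "foldr adjoin bs {0\<^sub>v n}"
  note S = vsubspace_foldr_adjoin[OF vsubspace_trivial bs(2)]
  have "card ?S = 2 ^ length ps"
    using card_foldr_adjoin[OF vsubspace_trivial bs(2,3)] bs(1) by simp
  also have "\<dots> < 2 ^ n" using Cons.prems(2) by simp
  finally have "?S \<noteq> carrier_vec n" using card_carrier_vec_bit[of n] by auto
  then obtain y where y: "y \<in> carrier_vec n" "y \<notin> ?S" using vsubspace_subset[OF S] by blast
  define x where "x = (if p \<in> ?S then y else p)"
  have x: "x \<in> carrier_vec n" "x \<notin> ?S" using y Cons.prems(1) by (auto simp: x_def)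
  have "p \<in> adjoin x ?S"
    using subset_adjoin[of ?S x] mem_adjoin[OF S x(1)] by (auto simp: x_def split: if_splits)
  then have "length (x # bs) = length (p # ps) \<and> set (x # bs) \<subseteq> carrier_vec n \<and>
    indep_over {0\<^sub>v n} (x # bs) \<and> set (p # ps) \<subseteq> foldr adjoin (x # bs) {0\<^sub>v n}"
    using bs x subset_adjoin[of ?S x] by auto
  then show ?case by blast
qed simp

text \<open>After i choices the span has \<open>2 ^ (r + i)\<close> elements, all to be avoided by
  the next choice. When j exceeds l - r, the factor with \<open>r + i = l\<close> is 0, in agreement
  with the absence of such lists.\<close>

lemma card_indep_lists:
  assumes V: "vsubspace n V" "card V = 2 ^ l" and U: "vsubspace n U" "U \<subseteq> V" "card U = 2 ^ r"
  shows "finite {xs. length xs = j \<and> set xs \<subseteq> V \<and> indep_over U xs} \<and>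
    card {xs. length xs = j \<and> set xs \<subseteq> V \<and> indep_over U xs} = (\<Prod>i<j. 2 ^ l - 2 ^ (r + i))"
proof (induction j)
  case 0
  have "{xs. length xs = 0 \<and> set xs \<subseteq> V \<and> indep_over U xs} = {[]}" by auto
  then show ?case by simp
next
  case (Suc j)
  let ?L = "\<lambda>j. {xs. length xs = j \<and> set xs \<subseteq> V \<and> indep_over U xs}"
  let ?S = "SIGMA xs:?L j. V - foldr adjoin xs U"
  have fV: "finite V" using finite_vsubspace[OF V(1)] .
  have inj: "inj_on (\<lambda>(xs, x). x # xs) ?S" by (auto simp: inj_on_def)
  have "?L (Suc j) = (\<lambda>(xs, x). x # xs) ` ?S"
    by (force simp: image_iff length_Suc_conv)
  moreover have "card ?S = (\<Sum>xs\<in>?L j. card (V - foldr adjoin xs U))"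
    using Suc fV by (intro card_SigmaI) auto
  moreover have "card (V - foldr adjoin xs U) = 2 ^ l - 2 ^ (r + j)" if "xs \<in> ?L j" for xs
  proof -
    have xs: "set xs \<subseteq> carrier_vec n" using that vsubspace_subset[OF V(1)] by auto
    have "foldr adjoin xs U \<subseteq> V" using that U V by (intro foldr_adjoin_subset) auto
    then have "card (V - foldr adjoin xs U) = card V - card (foldr adjoin xs U)"
      using fV by (intro card_Diff_subset) (auto intro: finite_subset)
    then show ?thesis using card_foldr_adjoin[OF U(1) xs] that V U by (simp add: power_add mult.commute)
  qed
  moreover have "finite ?S" using Suc fV by auto
  ultimately show ?case using Suc card_image[OF inj] by simp
qed

lemma prod_one_minus_half_powers_ge:
  "(\<Prod>i<k. 1 - (1 / 2) ^ Suc i :: real) \<ge> 1 / 4"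
proof -
  \<comment> \<open>The bound 1/4 alone does not survive a factor below 1, so a surplus
    \<open>t = (1 / 2) ^ (k + 2)\<close> is carried along. The next factor is \<open>1 - t\<close>,
    and \<open>t \<le> 1 / 4\<close> leaves a surplus of at least t / 2.\<close>
  have "(\<Prod>i<Suc k. 1 - (1 / 2) ^ Suc i :: real) \<ge> 1 / 4 + (1 / 2) ^ (k + 2)" for k
  proof (induction k)
    case (Suc k)
    define t :: real where "t = (1 / 2) ^ (k + 2)"
    have t: "0 \<le> t" "t \<le> 1 / 4"
      using power_decreasing[of 2 "k + 2" "1 / 2 :: real"] by (auto simp: t_def power2_eq_square)
    have "1 / 4 + t / 2 \<le> (1 / 4 + t) * (1 - t)"
      using mult_left_mono[OF t(2,1)] by (simp add: field_simps)
    also have "\<dots> \<le> (\<Prod>i<Suc k. 1 - (1 / 2) ^ Suc i) * (1 - t)"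
      using Suc t by (intro mult_right_mono) (auto simp: t_def)
    also have "\<dots> = (\<Prod>i<Suc (Suc k). 1 - (1 / 2) ^ Suc i :: real)"
      by (simp add: t_def)
    finally show ?case by (simp add: t_def)
  qed simp
  then have Suc: "(\<Prod>i<Suc k. 1 - (1 / 2) ^ Suc i :: real) \<ge> 1 / 4" for k
    using order_trans[of "1 / 4 :: real" "1 / 4 + (1 / 2) ^ (k + 2)"] by simp
  show ?thesis using Suc[of "k - 1"] by (cases k) simp_all
qed

text \<open>Dividing each factor by \<open>2 ^ l\<close> leaves
  \<open>1 - (1 / 2) ^ (k - i)\<close>; in reverse order these factors form the product just bounded
  below by 1/4.\<close>

lemma prod_power_diff_ge:
  "2 ^ (l * k) \<le> 4 * (\<Prod>i<k. 2 ^ l - 2 ^ (r + i) :: nat)" if "r + k = l"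
proof -
  have "real (\<Prod>i<k. 2 ^ l - 2 ^ (r + i)) = (\<Prod>i<k. 2 ^ l * (1 - (1 / 2) ^ (k - i)))"
    unfolding of_nat_prod
  proof (intro prod.cong refl)
    fix i assume "i \<in> {..<k}"
    then have "l = (k - i) + (r + i)" using that by simp
    then have "(2::real) ^ l * (1 / 2) ^ (k - i) = 2 ^ (k - i) * 2 ^ (r + i) / 2 ^ (k - i)"
      by (simp only: power_add power_divide) simp
    then have "(2::real) ^ l * (1 / 2) ^ (k - i) = 2 ^ (r + i)" by simp
    then show "real (2 ^ l - 2 ^ (r + i)) = 2 ^ l * (1 - (1 / 2) ^ (k - i))"
      using that \<open>i \<in> {..<k}\<close> by (subst of_nat_diff) (auto simp: algebra_simps intro!: power_increasing)
  qed
  also have "\<dots> = 2 ^ (l * k) * (\<Prod>i<k. 1 - (1 / 2) ^ (k - i))"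
    by (simp add: prod.distrib power_mult)
  also have "(\<Prod>i<k. 1 - (1 / 2) ^ (k - i) :: real) = (\<Prod>i<k. 1 - (1 / 2) ^ Suc i)"
    by (subst prod.nat_diff_reindex[symmetric]) (intro prod.cong refl, simp add: Suc_diff_Suc)
  finally have "real (\<Prod>i<k. 2 ^ l - 2 ^ (r + i)) \<ge> 2 ^ (l * k) * (1 / 4)"
    using prod_one_minus_half_powers_ge[of k] by simp
  then have "real (2 ^ (l * k)) \<le> real (4 * (\<Prod>i<k. 2 ^ l - 2 ^ (r + i)))"
    by simp
  then show ?thesis by (simp only: of_nat_le_iff)
qed

text \<open>The pairs of a space V and a list of l - r vectors extending Q to V are counted. Every V
  has at least \<open>2 ^ (l * (l - r)) / 4\<close> such lists, and a list determines V as its span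
  with Q, so there are at most as many pairs as lists of l - r elements of W.\<close>

lemma card_grassmann_interval_le:
  assumes Q: "vsubspace n Q" "card Q = 2 ^ r" and W: "finite W" "card W = 2 ^ w" and "r \<le> l"
  shows "card {V \<in> grassmann l n. Q \<subseteq> V \<and> V \<subseteq> W} * 2 ^ (l * (l - r)) \<le> 4 * 2 ^ (w * (l - r))"
proof -
  let ?I = "{V \<in> grassmann l n. Q \<subseteq> V \<and> V \<subseteq> W}" and ?k = "l - r"
  let ?L = "\<lambda>V. {xs. length xs = ?k \<and> set xs \<subseteq> V \<and> indep_over Q xs}"
  have fI: "finite ?I" using finite_grassmann by simp
  have L: "finite (?L V)" "card (?L V) = (\<Prod>i<?k. 2 ^ l - 2 ^ (r + i))" if "V \<in> ?I" for V
    using card_indep_lists[of n V l Q r ?k] that Q by (auto simp: grassmann_iff)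
  have span: "V = foldr adjoin xs Q" if "V \<in> ?I" "xs \<in> ?L V" for V xs
  proof -
    have V: "vsubspace n V" "card V = 2 ^ l" using that by (auto simp: grassmann_iff)
    have xs: "set xs \<subseteq> carrier_vec n" using that vsubspace_subset[OF V(1)] by auto
    have "card (foldr adjoin xs Q) = card V"
      using card_foldr_adjoin[OF Q(1) xs] that V(2) Q(2) \<open>r \<le> l\<close> by (simp flip: power_add)
    moreover have "foldr adjoin xs Q \<subseteq> V" using that V by (intro foldr_adjoin_subset) auto
    ultimately show ?thesis using card_subset_eq[OF finite_vsubspace[OF V(1)]] by blast
  qed
  have "card ?I * (\<Prod>i<?k. 2 ^ l - 2 ^ (r + i)) = card (SIGMA V:?I. ?L V)"
    using L fI by (subst card_SigmaI) auto
  also have "\<dots> \<le> card {xs. set xs \<subseteq> W \<and> length xs = ?k}"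
  proof (rule card_inj_on_le[where f = snd])
    show "inj_on snd (SIGMA V:?I. ?L V)"
    proof (rule inj_onI, clarsimp)
      fix V V' xs
      assume "V \<in> grassmann l n" "Q \<subseteq> V" "V \<subseteq> W" "length xs = ?k" "set xs \<subseteq> V" "indep_over Q xs"
        "V' \<in> grassmann l n" "Q \<subseteq> V'" "V' \<subseteq> W" "set xs \<subseteq> V'"
      then show "V = V'" using span[of V xs] span[of V' xs] by simp
    qed
    show "finite {xs. set xs \<subseteq> W \<and> length xs = ?k}"
      using W(1) by (rule finite_lists_length_eq)
  qed auto
  also have "\<dots> = 2 ^ (w * ?k)"
    using card_lists_length_eq[OF W(1), of ?k] W(2) by (simp add: power_mult)
  finally have "card ?I * (\<Prod>i<?k. 2 ^ l - 2 ^ (r + i)) \<le> 2 ^ (w * ?k)" .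
  then have "4 * (card ?I * (\<Prod>i<?k. 2 ^ l - 2 ^ (r + i))) \<le> 4 * 2 ^ (w * ?k)"
    by (rule mult_left_mono) simp
  moreover have "card ?I * 2 ^ (l * ?k) \<le> card ?I * (4 * (\<Prod>i<?k. 2 ^ l - 2 ^ (r + i)))"
    using prod_power_diff_ge[of r ?k l] \<open>r \<le> l\<close> by (intro mult_left_mono) auto
  ultimately show ?thesis by (simp only: mult.left_commute[of 4])
qed

section \<open>Orthogonal complements\<close>

definition perp :: "nat \<Rightarrow> bit vec set \<Rightarrow> bit vec set" where
  "perp n R = {x \<in> carrier_vec n. \<forall>y\<in>R. y \<bullet> x = 0}"

lemma vsubspace_perp:
  assumes "R \<subseteq> carrier_vec n"
  shows "vsubspace n (perp n R)"
proof (rule vsubspaceI)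
  show "0\<^sub>v n \<in> perp n R" using assms by (auto simp: perp_def)
next
  fix x y assume "x \<in> perp n R" "y \<in> perp n R"
  then show "x + y \<in> perp n R" using assms
    by (auto simp: perp_def scalar_prod_add_distrib[of _ n] subset_iff)
qed (auto simp: perp_def)

text \<open>Translation by u maps the kernel onto its complement in U.\<close>

lemma card_kernel_half:
  assumes U: "vsubspace n U" and h: "\<And>x y. x \<in> U \<Longrightarrow> y \<in> U \<Longrightarrow> h (x + y) = h x + (h y :: bit)"
    and u: "u \<in> U" "h u = 1"
  shows "2 * card {x \<in> U. h x = 0} = card U"
proof -
  let ?K = "{x \<in> U. h x = 0}"
  note c = vsubspace_carrier[OF U]
  have "h (0\<^sub>v n + 0\<^sub>v n) = h (0\<^sub>v n) + h (0\<^sub>v n)"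
    using h[OF vsubspace_zero[OF U] vsubspace_zero[OF U]] .
  then have K: "vsubspace n ?K"
    using vsubspace_zero[OF U] vsubspace_subset[OF U] vsubspace_add[OF U] h
    by (intro vsubspaceI) auto
  have "U \<subseteq> adjoin u ?K"
  proof
    fix v assume v: "v \<in> U"
    show "v \<in> adjoin u ?K"
    proof (cases "h v = 0")
      case False
      then have "u + v \<in> ?K" using v u vsubspace_add[OF U] h by simp
      moreover have "v = u + (u + v)" using bit_vec_add_cancel[OF c[OF u(1)] c[OF v]] by simp
      ultimately show ?thesis unfolding adjoin_def by blast
    qed (use v in \<open>simp add: adjoin_def\<close>)
  qed
  moreover have "adjoin u ?K \<subseteq> U" using adjoin_subset[OF U _ u(1)] by simp
  ultimately have "adjoin u ?K = U" by simp
  then show ?thesis using card_adjoin[OF K c[OF u(1)]] u(2) by simp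
qed

lemma scalar_prod_unit_exists:
  assumes "y \<in> carrier_vec n" "y \<noteq> (0\<^sub>v n :: bit vec)"
  obtains x where "x \<in> carrier_vec n" "y \<bullet> x = 1"
proof -
  have "\<exists>i<n. y $ i = 1"
  proof (rule ccontr)
    assume "\<not> ?thesis"
    then have "y = 0\<^sub>v n" using assms(1) by (intro eq_vecI) auto
    then show False using assms(2) by simp
  qed
  then obtain i where "i < n" "y $ i = 1" by blast
  then show ?thesis using that[of "unit_vec n i"] assms(1) by simp
qed

text \<open>Orthogonal pairs (x, y) with y in R are counted by x and by y. Each count is the kernel
  of a functional: everything if the functional vanishes, half otherwise. It vanishes for x in the
  orthogonal complement, respectively for y = 0, and comparing the doubled counts gives the
  identity.\<close>

lemma card_perp:
  assumes R: "vsubspace n R"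
  shows "card (perp n R) * card R = 2 ^ n"
proof -
  let ?X = "carrier_vec n :: bit vec set"
  note cR = vsubspace_carrier[OF R]
  have fR: "finite R" using finite_vsubspace[OF R] .
  have z: "0\<^sub>v n \<in> R" using vsubspace_zero[OF R] .
  have "(\<Sum>x\<in>?X. card {y \<in> R. y \<bullet> x = 0}) = (\<Sum>y\<in>R. card {x \<in> ?X. y \<bullet> x = 0})"
    using sum.swap[of "\<lambda>x y. of_bool (y \<bullet> x = 0) :: nat" R ?X]
    by (simp add: fR Int_def)
  then have eq: "(\<Sum>x\<in>?X. 2 * card {y \<in> R. y \<bullet> x = 0}) = (\<Sum>y\<in>R. 2 * card {x \<in> ?X. y \<bullet> x = 0})"
    by (simp flip: sum_distrib_left)
  have "(\<Sum>x\<in>?X. 2 * card {y \<in> R. y \<bullet> x = 0}) = (\<Sum>x\<in>?X. card R + (if x \<in> perp n R then card R else 0))"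
  proof (intro sum.cong refl)
    fix x assume x: "x \<in> ?X"
    show "2 * card {y \<in> R. y \<bullet> x = 0} = card R + (if x \<in> perp n R then card R else 0)"
    proof (cases "x \<in> perp n R")
      case True
      then have "{y \<in> R. y \<bullet> x = 0} = R" by (auto simp: perp_def)
      then show ?thesis using True by simp
    next
      case False
      then obtain u where "u \<in> R" "u \<bullet> x = 1" using x by (auto simp: perp_def)
      moreover have "(y + y') \<bullet> x = y \<bullet> x + y' \<bullet> x" if "y \<in> R" "y' \<in> R" for y y'
        using add_scalar_prod_distrib[OF cR[OF that(1)] cR[OF that(2)] x] .
      ultimately show ?thesis using card_kernel_half[OF R, of "\<lambda>y. y \<bullet> x"] False by simp
    qed
  qed
  also have "\<dots> = card ?X * card R + card (perp n R) * card R"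
  proof -
    have "?X \<inter> perp n R = perp n R" by (auto simp: perp_def)
    then show ?thesis by (simp add: sum.distrib flip: sum.inter_restrict)
  qed
  finally have lhs: "(\<Sum>x\<in>?X. 2 * card {y \<in> R. y \<bullet> x = 0}) =
    card ?X * card R + card (perp n R) * card R" .
  have "(\<Sum>y\<in>R. 2 * card {x \<in> ?X. y \<bullet> x = 0}) = (\<Sum>y\<in>R. card ?X + (if y = 0\<^sub>v n then card ?X else 0))"
  proof (intro sum.cong refl)
    fix y assume y: "y \<in> R"
    show "2 * card {x \<in> ?X. y \<bullet> x = 0} = card ?X + (if y = 0\<^sub>v n then card ?X else 0)"
    proof (cases "y = 0\<^sub>v n")
      case True
      then have "{x \<in> ?X. y \<bullet> x = 0} = ?X" by auto
      then show ?thesis using True by simp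
    next
      case False
      then obtain u where "u \<in> ?X" "y \<bullet> u = 1" using scalar_prod_unit_exists[OF cR[OF y]] by blast
      moreover have "y \<bullet> (x + x') = y \<bullet> x + y \<bullet> x'" if "x \<in> ?X" "x' \<in> ?X" for x x'
        using scalar_prod_add_distrib[OF cR[OF y] that] .
      ultimately show ?thesis
        using card_kernel_half[OF vsubspace_carrier_vec[of n], of "\<lambda>x. y \<bullet> x"] False by simp
    qed
  qed
  also have "\<dots> = card R * card ?X + card ?X"
    using z fR by (simp add: sum.distrib)
  finally show ?thesis using eq lhs by (simp add: card_carrier_vec_bit mult.commute)
qed

section \<open>Averaging over fibres and matrices with prescribed products\<close>

text \<open>If G had density below c in every fibre, summing over the fibres would give density
  below c in S. Naming the fibre by a point of S ensures that it is nonempty.\<close>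

lemma fiber_averaging:
  assumes S: "finite S" "S \<noteq> {}" and G: "G \<subseteq> S" "c * real (card S) \<le> real (card G)"
  obtains x where "x \<in> S" "c * real (card {y \<in> S. f y = f x}) \<le> real (card {y \<in> G. f y = f x})"
proof -
  have fib: "card A = (\<Sum>v\<in>f ` S. card {y \<in> A. f y = v})" if "A \<subseteq> S" for A
  proof -
    have "A = (\<Union>v\<in>f ` S. {y \<in> A. f y = v})" using that by auto
    also have "card \<dots> = (\<Sum>v\<in>f ` S. card {y \<in> A. f y = v})"
      using S finite_subset[OF that S(1)] by (intro card_UN_disjoint) auto
    finally show ?thesis .
  qed
  have "\<exists>v\<in>f ` S. c * real (card {y \<in> S. f y = v}) \<le> real (card {y \<in> G. f y = v})"
  proof (rule ccontr)
    assume "\<not> ?thesis"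
    then have "(\<Sum>v\<in>f ` S. real (card {y \<in> G. f y = v})) < (\<Sum>v\<in>f ` S. c * real (card {y \<in> S. f y = v}))"
      using S by (intro sum_strict_mono) (auto simp: not_le)
    also have "\<dots> = c * real (card S)" using fib[of S] by (simp add: sum_distrib_left)
    finally have "real (card G) < c * real (card S)" using fib[OF G(1)] by simp
    then show False using G(2) by simp
  qed
  then show ?thesis using that by blast
qed

lemma bit_mat_add_cancel:
  assumes "A \<in> carrier_mat l m" "B \<in> carrier_mat l m"
  shows "A + (A + B) = (B :: bit mat)"
  using assms by (intro eq_matI) (auto simp flip: add.assoc)

text \<open>The matrices are split into classes by all the prescribed products. There are at most
  \<open>2 ^ (r * m + r * l)\<close> classes, and a translation embeds each of them into K, so K has
  at least an average share.\<close>

lemma card_mat_constraint_class_ge: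
  fixes M0 :: "bit mat"
  assumes B: "finite B" "card B \<le> r" "B \<subseteq> carrier_vec l"
    and C: "finite C" "card C \<le> r" "C \<subseteq> carrier_vec m"
    and M0: "M0 \<in> carrier_mat l m"
  defines "K \<equiv> {M \<in> carrier_mat l m. (\<forall>p\<in>B. transpose_mat M *\<^sub>v p = transpose_mat M0 *\<^sub>v p) \<and>
     (\<forall>q\<in>C. M *\<^sub>v q = M0 *\<^sub>v q)}"
  shows "2 ^ (l * m) \<le> card K * 2 ^ (r * m + r * l)" (is "_ \<le> _ * ?N")
proof -
  let ?X = "carrier_mat l m :: bit mat set"
  define \<kappa> where "\<kappa> M = (restrict (\<lambda>p. transpose_mat M *\<^sub>v p) B, restrict (\<lambda>q. M *\<^sub>v q) C)"
    for M :: "bit mat"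
  let ?Y = "(B \<rightarrow>\<^sub>E carrier_vec m) \<times> (C \<rightarrow>\<^sub>E carrier_vec l) :: ((bit vec \<Rightarrow> bit vec) \<times> (bit vec \<Rightarrow> bit vec)) set"
  have \<kappa>_eq: "\<kappa> M = \<kappa> M' \<longleftrightarrow> (\<forall>p\<in>B. transpose_mat M *\<^sub>v p = transpose_mat M' *\<^sub>v p) \<and>
    (\<forall>q\<in>C. M *\<^sub>v q = M' *\<^sub>v q)" for M M'
    by (auto simp: \<kappa>_def restrict_def fun_eq_iff split: if_splits)
  have finY: "finite ?Y" using B(1) C(1) by (intro finite_cartesian_product finite_PiE) auto
  have fin: "finite (\<kappa> ` ?X)" by simp
  have "\<kappa> ` ?X \<subseteq> ?Y"
    using B(3) C(3) by (auto simp: \<kappa>_def simp del: mult_mat_vec_carrier intro!: mult_mat_vec_carrier)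
  then have "card (\<kappa> ` ?X) \<le> card ?Y" using finY by (intro card_mono)
  also have "\<dots> = 2 ^ (card B * m + card C * l)"
    using B(1) C(1) by (simp add: card_PiE card_cartesian_product card_carrier_vec_bit power_add
        mult.commute[of _ "card _"] flip: power_mult)
  also have "\<dots> \<le> ?N" using B(2) C(2) by (intro power_increasing add_mono mult_right_mono) auto
  finally have im: "card (\<kappa> ` ?X) \<le> ?N" .
  have fiber: "card {M \<in> ?X. \<kappa> M = v} \<le> card K" if "v \<in> \<kappa> ` ?X" for v
  proof -
    obtain M1 where M1: "M1 \<in> ?X" "v = \<kappa> M1" using \<open>v \<in> \<kappa> ` ?X\<close> by blast
    \<comment> \<open>Adding M1 + M0 moves the class of M1 into that of M0: the products with M1 and
      with M agree and cancel, leaving those with M0.\<close>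
    show ?thesis
    proof (rule card_inj_on_le[where f = "\<lambda>M. (M1 + M0) + M"])
      show "inj_on (\<lambda>M. (M1 + M0) + M) {M \<in> ?X. \<kappa> M = v}"
        using M0 M1 by (intro inj_on_inverseI[where g = "\<lambda>M. (M1 + M0) + M"] bit_mat_add_cancel) auto
      show "finite K" by (simp add: K_def)
      have cancel: "(a + b) + a = b" if "a \<in> carrier_vec k" "b \<in> carrier_vec k" for a b :: "bit vec" and k
        using that comm_add_vec[of a k b] by (simp add: bit_vec_add_self)
      have distrib: "((A1 + A2) + A3) *\<^sub>v v = (A1 *\<^sub>v v + A2 *\<^sub>v v) + A3 *\<^sub>v v"
        if "A1 \<in> carrier_mat i j" "A2 \<in> carrier_mat i j" "A3 \<in> carrier_mat i j" "v \<in> carrier_vec j"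
        for A1 A2 A3 :: "bit mat" and v i j
        using add_mult_distrib_mat_vec[of "A1 + A2" i j A3 v] add_mult_distrib_mat_vec[of A1 i j A2 v]
          that by simp
      show "(\<lambda>M. (M1 + M0) + M) ` {M \<in> ?X. \<kappa> M = v} \<subseteq> K"
      proof (rule image_subsetI)
        fix M assume "M \<in> {M \<in> ?X. \<kappa> M = v}"
        then have M: "M \<in> ?X" "\<kappa> M = \<kappa> M1" using M1 by auto
        have "transpose_mat ((M1 + M0) + M) *\<^sub>v p = transpose_mat M0 *\<^sub>v p" if "p \<in> B" for p
        proof -
          have p: "p \<in> carrier_vec l" using that B by auto
          have "transpose_mat ((M1 + M0) + M) = (transpose_mat M1 + transpose_mat M0) + transpose_mat M"
            using M0 M1 M by (intro eq_matI) auto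
          also have "\<dots> *\<^sub>v p = (transpose_mat M1 *\<^sub>v p + transpose_mat M0 *\<^sub>v p) + transpose_mat M *\<^sub>v p"
            using M0 M1 M p by (intro distrib[of _ m l]) auto
          also have "transpose_mat M *\<^sub>v p = transpose_mat M1 *\<^sub>v p" using M(2) that \<kappa>_eq by blast
          finally show ?thesis using M0 M1 p by (simp add: cancel[of _ m])
        qed
        moreover have "((M1 + M0) + M) *\<^sub>v q = M0 *\<^sub>v q" if "q \<in> C" for q
        proof -
          have q: "q \<in> carrier_vec m" using that C by auto
          have "((M1 + M0) + M) *\<^sub>v q = (M1 *\<^sub>v q + M0 *\<^sub>v q) + M *\<^sub>v q"
            using M0 M1 M q by (intro distrib[of _ l m]) auto
          also have "M *\<^sub>v q = M1 *\<^sub>v q" using M(2) that \<kappa>_eq by blast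
          finally show ?thesis using M0 M1 q by (simp add: cancel[of _ l])
        qed
        ultimately show "(M1 + M0) + M \<in> K" using M0 M1 M by (auto simp: K_def)
      qed
    qed
  qed
  have "?X = (\<Union>v\<in>\<kappa> ` ?X. {M \<in> ?X. \<kappa> M = v})" by auto
  then have "card ?X \<le> (\<Sum>v\<in>\<kappa> ` ?X. card {M \<in> ?X. \<kappa> M = v})"
    using card_UN_le[OF fin, of "\<lambda>v. {M \<in> ?X. \<kappa> M = v}"] by simp
  also have "\<dots> \<le> card (\<kappa> ` ?X) * card K"
    using sum_bounded_above[of "\<kappa> ` ?X" _ "card K"] fiber by simp
  also have "\<dots> \<le> ?N * card K" using im by (rule mult_right_mono) simp
  finally show ?thesis by (simp add: card_carrier_mat_bit mult.commute)
qed

section \<open>Graph subspaces and the shortcode test\<close>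

lemma linear_functional_on_iff:
  assumes "vsubspace n V"
  shows "linear_functional_on V f \<longleftrightarrow> (\<forall>x\<in>V. \<forall>y\<in>V. f (x + y) = f x + f y)"
proof
  assume add: "\<forall>x\<in>V. \<forall>y\<in>V. f (x + y) = f x + f y"
  have "f (c \<cdot>\<^sub>v x) = c * f x" if x: "x \<in> V" for c x
  proof (cases "c = 0")
    case True
    have "f (0\<^sub>v n + 0\<^sub>v n) = f (0\<^sub>v n) + f (0\<^sub>v n)" using add vsubspace_zero[OF assms] by blast
    moreover have "0 \<cdot>\<^sub>v x = 0\<^sub>v n" using vsubspace_carrier[OF assms x] by (intro eq_vecI) auto
    ultimately show ?thesis using True by simp
  qed simp
  then show "linear_functional_on V f" using add by (simp add: linear_functional_on_def)
qed (simp add: linear_functional_on_def)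

lemma additive_eq_scalar_prod:
  fixes h :: "bit vec \<Rightarrow> bit"
  assumes h: "\<And>x y. x \<in> carrier_vec l \<Longrightarrow> y \<in> carrier_vec l \<Longrightarrow> h (x + y) = h x + h y"
    and p: "p \<in> carrier_vec l"
  shows "vec l (\<lambda>i. h (unit_vec l i)) \<bullet> p = h p"
proof -
  let ?y = "vec l (\<lambda>i. h (unit_vec l i))"
  have y: "?y \<in> carrier_vec l" by simp
  \<comment> \<open>Induction on a bound k for the support of p. A nonzero coordinate k is cleared
    by adding the unit vector, on which both sides agree by the choice of \<open>?y\<close>.\<close>
  have "k \<le> l \<Longrightarrow> p \<in> carrier_vec l \<Longrightarrow> (\<And>i. k \<le> i \<Longrightarrow> i < l \<Longrightarrow> p $ i = 0) \<Longrightarrow> ?y \<bullet> p = h p" for k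
  proof (induction k arbitrary: p)
    case 0
    then have "p = 0\<^sub>v l" by (intro eq_vecI) auto
    moreover have "h (0\<^sub>v l + 0\<^sub>v l) = h (0\<^sub>v l) + h (0\<^sub>v l)" by (rule h) auto
    ultimately show ?case by simp
  next
    case (Suc k)
    show ?case
    proof (cases "p $ k = 0")
      case True
      have "p $ i = 0" if "k \<le> i" "i < l" for i
        using that True Suc.prems(3)[of i] by (cases "i = k") auto
      then show ?thesis using Suc.prems by (intro Suc.IH) auto
    next
      case False
      let ?e = "unit_vec l k :: bit vec"
      have e: "?e \<in> carrier_vec l" by simp
      have "(?e + p) $ i = 0" if "k \<le> i" "i < l" for i
        using that Suc.prems False by (cases "i = k") auto
      then have "?y \<bullet> (?e + p) = h (?e + p)"
        using Suc.prems e by (intro Suc.IH) auto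
      moreover have "?y \<bullet> (?e + p) = ?y \<bullet> ?e + ?y \<bullet> p"
        using scalar_prod_add_distrib[OF y e Suc.prems(2)] .
      moreover have "?y \<bullet> ?e = h ?e" using Suc.prems(1) by simp
      ultimately show ?thesis using h[OF e Suc.prems(2)] by simp
    qed
  qed
  from this[of l] p show ?thesis by simp
qed

text \<open>The double orthogonal complement of a is contained in {0, a}. Unit vectors orthogonal to
  a confine the support of d to that of a. If d is neither 0 nor a, take i in the support of d and j
  in that of a but not of d: the sum of their unit vectors is orthogonal to a but not to d.\<close>

lemma vec_in_line_if_annihilates_perp:
  fixes a d :: "bit vec"
  assumes a: "a \<in> carrier_vec l" and d: "d \<in> carrier_vec l"
    and ann: "\<And>p. p \<in> carrier_vec l \<Longrightarrow> a \<bullet> p = 0 \<Longrightarrow> d \<bullet> p = 0"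
  shows "d = 0\<^sub>v l \<or> d = a"
proof (rule ccontr)
  assume neg: "\<not> ?thesis"
  let ?e = "unit_vec l :: nat \<Rightarrow> bit vec"
  have sub: "a $ i = 1" if "i < l" "d $ i = 1" for i
    using ann[of "?e i"] that a d by (cases "a $ i = 0") auto
  obtain i where i: "i < l" "d $ i = 1"
  proof -
    have "\<exists>i<l. d $ i \<noteq> 0"
    proof (rule ccontr)
      assume "\<not> ?thesis"
      then have "d = 0\<^sub>v l" using d by (intro eq_vecI) auto
      then show False using neg by simp
    qed
    then show ?thesis using that by auto
  qed
  obtain j where j: "j < l" "d $ j \<noteq> a $ j"
  proof -
    have "\<exists>j<l. d $ j \<noteq> a $ j"
    proof (rule ccontr)
      assume "\<not> ?thesis"
      then have "d = a" using a d by (intro eq_vecI) auto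
      then show False using neg by simp
    qed
    then show ?thesis using that by blast
  qed
  have "d $ j = 0" "a $ j = 1" using j sub[OF j(1)] by (cases "d $ j = 0"; auto)+
  moreover have "v \<bullet> (?e i + ?e j) = v $ i + v $ j" if "v \<in> carrier_vec l" for v
    using scalar_prod_add_distrib[OF that, of "?e i" "?e j"] that i(1) j(1) by simp
  ultimately have "a \<bullet> (?e i + ?e j) = 0" "d \<bullet> (?e i + ?e j) = 1"
    using a d i sub[OF i] by simp_all
  then show False using ann[of "?e i + ?e j"] by simp
qed

lemma mat_eq_if_mult_vec_eq:
  fixes A B :: "bit mat"
  assumes "A \<in> carrier_mat l m" "B \<in> carrier_mat l m"
    and "\<And>p. p \<in> carrier_vec l \<Longrightarrow> transpose_mat A *\<^sub>v p = transpose_mat B *\<^sub>v p"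
  shows "A = B"
proof (rule eq_matI)
  fix i j assume ij: "i < dim_row B" "j < dim_col B"
  have "(transpose_mat A *\<^sub>v unit_vec l i) $ j = (transpose_mat B *\<^sub>v unit_vec l i) $ j"
    using assms(3)[of "unit_vec l i"] by simp
  then show "A $$ (i, j) = B $$ (i, j)" using assms(1,2) ij by simp
qed (use assms in auto)

section \<open>Rank-one perturbations and graph subspaces\<close>

lemma outer_prod_carrier [simp]:
  "a \<in> carrier_vec l \<Longrightarrow> b \<in> carrier_vec m \<Longrightarrow> outer_prod a b \<in> carrier_mat l m"
  by (auto simp: outer_prod_def)

lemma transpose_outer_prod_mult_vec:
  fixes a b p :: "bit vec"
  assumes "a \<in> carrier_vec l" "b \<in> carrier_vec m" "p \<in> carrier_vec l"
  shows "transpose_mat (outer_prod a b) *\<^sub>v p = (a \<bullet> p) \<cdot>\<^sub>v b"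
  using assms
  by (intro eq_vecI) (auto simp: outer_prod_def scalar_prod_def sum_distrib_left sum_distrib_right
      intro!: sum.cong)

text \<open>The perturbation is invisible on the orthogonal complement of a, which is why test pairs
  yield adjacent graph spaces.\<close>

lemma transpose_add_outer_prod_mult_vec:
  fixes M :: "bit mat"
  assumes "M \<in> carrier_mat l m" "a \<in> carrier_vec l" "b \<in> carrier_vec m" "p \<in> carrier_vec l"
  shows "transpose_mat (M + outer_prod a b) *\<^sub>v p = transpose_mat M *\<^sub>v p + (a \<bullet> p) \<cdot>\<^sub>v b"
proof -
  have "transpose_mat (M + outer_prod a b) = transpose_mat M + transpose_mat (outer_prod a b)"
    using assms by (intro eq_matI) (auto simp: outer_prod_def)
  then show ?thesis
    using add_mult_distrib_mat_vec[of "transpose_mat M" m l "transpose_mat (outer_prod a b)" p] assms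
      transpose_outer_prod_mult_vec[OF assms(2-4)] by simp
qed

text \<open>\<open>graph_space l M\<close> is the row space of \<open>[1 | M]\<close>.\<close>

definition graph_point :: "bit mat \<Rightarrow> bit vec \<Rightarrow> bit vec" where
  "graph_point M p = p @\<^sub>v (transpose_mat M *\<^sub>v p)"

definition graph_space :: "nat \<Rightarrow> bit mat \<Rightarrow> bit vec set" where
  "graph_space l M = graph_point M ` carrier_vec l"

context
  fixes l m :: nat
begin

lemma graph_point_carrier:
  "M \<in> carrier_mat l m \<Longrightarrow> p \<in> carrier_vec l \<Longrightarrow> graph_point M p \<in> carrier_vec (l + m)"
  by (auto simp: graph_point_def)

lemma graph_point_add:
  assumes "M \<in> carrier_mat l m" "p \<in> carrier_vec l" "p' \<in> carrier_vec l"
  shows "graph_point M (p + p') = graph_point M p + graph_point M p'"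
  using assms append_vec_add[OF assms(2,3), of "transpose_mat M *\<^sub>v p" m "transpose_mat M *\<^sub>v p'"]
    mult_add_distrib_mat_vec[of "transpose_mat M" m l p p']
  by (simp add: graph_point_def)

lemma graph_point_eq_iff:
  assumes "p \<in> carrier_vec l" "p' \<in> carrier_vec l"
  shows "graph_point M p = graph_point M' p' \<longleftrightarrow> p = p' \<and> transpose_mat M *\<^sub>v p = transpose_mat M' *\<^sub>v p'"
  using append_vec_eq[OF assms] by (simp add: graph_point_def)

text \<open>The general P serves twice: all of F_2^l gives the graph space, and the span of the row
  constraints will give Q.\<close>

lemma graph_point_image:
  assumes M: "M \<in> carrier_mat l m" and P: "vsubspace l P"
  shows "vsubspace (l + m) (graph_point M ` P)" "card (graph_point M ` P) = card P"
proof -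
  note c = vsubspace_carrier[OF P]
  show "vsubspace (l + m) (graph_point M ` P)"
  proof (rule vsubspaceI)
    show "graph_point M ` P \<subseteq> carrier_vec (l + m)" using graph_point_carrier[OF M] c by auto
    have "graph_point M (0\<^sub>v l) = 0\<^sub>v (l + m)"
      using M by (intro eq_vecI) (auto simp: graph_point_def)
    then show "0\<^sub>v (l + m) \<in> graph_point M ` P" using vsubspace_zero[OF P] by (metis image_eqI)
  next
    fix x y assume "x \<in> graph_point M ` P" "y \<in> graph_point M ` P"
    then obtain p p' where p: "p \<in> P" "p' \<in> P" "x = graph_point M p" "y = graph_point M p'" by auto
    then have "x + y = graph_point M (p + p')" using graph_point_add[OF M] c by simp
    then show "x + y \<in> graph_point M ` P" using vsubspace_add[OF P] p by blast
  qed
  have "inj_on (graph_point M) P" using graph_point_eq_iff c by (auto intro!: inj_onI)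
  then show "card (graph_point M ` P) = card P" by (rule card_image)
qed

lemma graph_space_in_grassmann:
  "M \<in> carrier_mat l m \<Longrightarrow> graph_space l M \<in> grassmann l (l + m)"
  using graph_point_image[OF _ vsubspace_carrier_vec]
  by (simp add: grassmann_iff graph_space_def card_carrier_vec_bit)

lemma graph_space_inject:
  assumes "M \<in> carrier_mat l m" "M' \<in> carrier_mat l m" "graph_space l M = graph_space l M'"
  shows "M = M'"
proof (rule mat_eq_if_mult_vec_eq[OF assms(1,2)])
  fix p :: "bit vec" assume p: "p \<in> carrier_vec l"
  then have "graph_point M p \<in> graph_space l M'" using assms(3) by (auto simp: graph_space_def)
  then obtain p' where "p' \<in> carrier_vec l" "graph_point M p = graph_point M' p'"
    by (auto simp: graph_space_def)
  then show "transpose_mat M *\<^sub>v p = transpose_mat M' *\<^sub>v p" using graph_point_eq_iff p by auto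
qed

text \<open>The first block of a point is p, so the two spaces meet exactly in the points over the
  orthogonal complement of a, which is half of F_2^l. Over the other half the points differ by the
  nonzero vector b in the second block.\<close>

lemma graph_space_edge:
  assumes M: "M \<in> carrier_mat l m" and a: "a \<in> carrier_vec l" "a \<noteq> 0\<^sub>v l"
    and b: "b \<in> carrier_vec m" "b \<noteq> 0\<^sub>v m"
  shows "(graph_space l M, graph_space l (M + outer_prod a b)) \<in> grassmann_edges l (l + m)"
proof -
  let ?M = "M + outer_prod a b" and ?K = "{p \<in> carrier_vec l. a \<bullet> p = 0}"
  have M': "?M \<in> carrier_mat l m" using M a b by simp
  have eq: "graph_point M p = graph_point ?M p \<longleftrightarrow> a \<bullet> p = 0" if p: "p \<in> carrier_vec l" for p
  proof -
    let ?v = "transpose_mat M *\<^sub>v p"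
    have v: "?v \<in> carrier_vec m" using M p by simp
    have "graph_point M p = graph_point ?M p \<longleftrightarrow> ?v = ?v + (a \<bullet> p) \<cdot>\<^sub>v b"
      using graph_point_eq_iff[OF p p] transpose_add_outer_prod_mult_vec[OF M a(1) b(1) p] by simp
    also have "\<dots> \<longleftrightarrow> (a \<bullet> p) \<cdot>\<^sub>v b = 0\<^sub>v m"
    proof
      assume "?v = ?v + (a \<bullet> p) \<cdot>\<^sub>v b"
      then have "?v + ?v = ?v + (?v + (a \<bullet> p) \<cdot>\<^sub>v b)" by simp
      then show "(a \<bullet> p) \<cdot>\<^sub>v b = 0\<^sub>v m"
        using v b(1) by (simp add: bit_vec_add_cancel[of _ m] bit_vec_add_self[of _ m])
    qed (use v in simp)
    also have "\<dots> \<longleftrightarrow> a \<bullet> p = 0"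
    proof (cases "a \<bullet> p = 0")
      case True
      have "0 \<cdot>\<^sub>v b = 0\<^sub>v m" using b(1) by (intro eq_vecI) auto
      then show ?thesis using True by simp
    qed (use b in simp)
    finally show ?thesis .
  qed
  have "graph_space l M \<inter> graph_space l ?M = graph_point M ` ?K"
  proof (intro equalityI subsetI)
    fix x assume "x \<in> graph_space l M \<inter> graph_space l ?M"
    then obtain p p' where p: "p \<in> carrier_vec l" "p' \<in> carrier_vec l"
      "x = graph_point M p" "x = graph_point ?M p'" by (auto simp: graph_space_def)
    then have "graph_point M p = graph_point ?M p" using graph_point_eq_iff by metis
    then show "x \<in> graph_point M ` ?K" using eq p by blast
  next
    fix x assume "x \<in> graph_point M ` ?K"
    then obtain p where p: "p \<in> carrier_vec l" "a \<bullet> p = 0" "x = graph_point M p" by blast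
    then have "x = graph_point ?M p" using eq by simp
    then show "x \<in> graph_space l M \<inter> graph_space l ?M"
      unfolding graph_space_def using p by blast
  qed
  moreover have "card (graph_point M ` ?K) = card ?K"
    using graph_point_eq_iff by (intro card_image inj_onI) auto
  moreover have "2 * card ?K = 2 ^ l"
  proof -
    obtain u where "u \<in> carrier_vec l" "a \<bullet> u = 1" using scalar_prod_unit_exists[OF a] .
    then show ?thesis
      using card_kernel_half[OF vsubspace_carrier_vec[of l], of "\<lambda>p. a \<bullet> p" u]
        scalar_prod_add_distrib[OF a(1)] card_carrier_vec_bit by simp
  qed
  ultimately show ?thesis
    using graph_space_in_grassmann[OF M] graph_space_in_grassmann[OF M'] by (simp add: grassmann_edges_iff)
qed

section \<open>Encoding an assignment as a shortcode map\<close>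

text \<open>\<open>graph_point M (unit_vec l i)\<close> is row i of [1 | M]. The map g is the change
  of coordinates: the entries describe the assignment pulled back along g.\<close>

definition shortcode_map ::
    "(bit vec \<Rightarrow> bit vec) \<Rightarrow> (bit vec set \<Rightarrow> bit vec \<Rightarrow> bit) \<Rightarrow> bit mat \<Rightarrow> bit vec" where
  "shortcode_map g F M = vec l (\<lambda>i. F (g ` graph_space l M) (g (graph_point M (unit_vec l i))))"

lemma shortcode_map_carrier [simp]: "shortcode_map g F M \<in> carrier_vec l"
  by (simp add: shortcode_map_def)

context
  fixes F :: "bit vec set \<Rightarrow> bit vec \<Rightarrow> bit" and g :: "bit vec \<Rightarrow> bit vec"
  assumes F: "\<And>V. V \<in> grassmann l (l + m) \<Longrightarrow> linear_functional_on V (F V)"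
    and g: "g \<in> vs_aut (l + m)"
begin

lemma shortcode_map_scalar_prod:
  assumes M: "M \<in> carrier_mat l m" and p: "p \<in> carrier_vec l"
  shows "shortcode_map g F M \<bullet> p = F (g ` graph_space l M) (g (graph_point M p))"
  unfolding shortcode_map_def
proof (rule additive_eq_scalar_prod[where h = "\<lambda>p. F (g ` graph_space l M) (g (graph_point M p))", OF _ p])
  fix x y :: "bit vec"
  assume xy: "x \<in> carrier_vec l" "y \<in> carrier_vec l"
  have "g (graph_point M (x + y)) = g (graph_point M x) + g (graph_point M y)"
    using graph_point_add[OF M xy] vs_isoD(6)[OF vs_autD[OF g]] graph_point_carrier[OF M] xy by simp
  moreover have "linear_functional_on (g ` graph_space l M) (F (g ` graph_space l M))"
    using F grassmann_vs_aut[OF g graph_space_in_grassmann[OF M]] .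
  ultimately show "F (g ` graph_space l M) (g (graph_point M (x + y))) =
      F (g ` graph_space l M) (g (graph_point M x)) + F (g ` graph_space l M) (g (graph_point M y))"
    using xy by (simp add: linear_functional_on_def graph_space_def)
qed

text \<open>On the orthogonal complement of a the two graph points coincide, and their image lies in
  both spaces, so the encoded functionals agree there. Their difference annihilates that complement
  and is therefore 0 or a.\<close>

lemma shortcode_map_consistent:
  assumes M: "M \<in> carrier_mat l m" and a: "a \<in> carrier_vec l" and b: "b \<in> carrier_vec m"
    and V: "V = g ` graph_space l M" "V' = g ` graph_space l (M + outer_prod a b)"
    and eq: "restrict (F V) (V \<inter> V') = restrict (F V') (V \<inter> V')"
  shows "shortcode_map g F (M + outer_prod a b) \<in> {shortcode_map g F M, shortcode_map g F M + a}"
proof -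
  let ?M = "M + outer_prod a b"
  let ?y = "shortcode_map g F M" and ?y' = "shortcode_map g F ?M"
  have M': "?M \<in> carrier_mat l m" using M a b by simp
  have "?y + ?y' = 0\<^sub>v l \<or> ?y + ?y' = a"
  proof (rule vec_in_line_if_annihilates_perp[OF a])
    fix p :: "bit vec" assume p: "p \<in> carrier_vec l" and ap: "a \<bullet> p = 0"
    have "0 \<cdot>\<^sub>v b = 0\<^sub>v m" using b by (intro eq_vecI) auto
    then have "graph_point ?M p = graph_point M p"
      using transpose_add_outer_prod_mult_vec[OF M a b p] ap M p by (simp add: graph_point_def)
    then have x: "g (graph_point M p) \<in> V \<inter> V'" "g (graph_point ?M p) = g (graph_point M p)"
      using p unfolding V graph_space_def by (auto intro!: imageI) (metis imageI)
    have "F V (g (graph_point M p)) = F V' (g (graph_point M p))"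
      using fun_cong[OF eq, of "g (graph_point M p)"] x by simp
    then have "?y \<bullet> p = ?y' \<bullet> p"
      using shortcode_map_scalar_prod[OF M p] shortcode_map_scalar_prod[OF M' p] x V by simp
    then show "(?y + ?y') \<bullet> p = 0" using p by (simp add: add_scalar_prod_distrib[of _ l])
  qed simp
  moreover have "?y' = ?y + (?y + ?y')"
    using bit_vec_add_cancel[of ?y l ?y'] by simp
  ultimately show ?thesis by auto
qed

end

end

section \<open>Transfer of the acceptance probability\<close>

lemma prob_pmf_of_set:
  assumes "finite A" "A \<noteq> {}"
  shows "\<P>(x in pmf_of_set A. P x) = real (card {x \<in> A. P x}) / real (card A)"
  using assms by (simp add: measure_pmf_of_set Int_def)

text \<open>For an empty condition both quotients are 0 by convention.\<close>

lemma cond_prob_pmf_of_set: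
  assumes "finite A" "A \<noteq> {}"
  shows "\<P>(x in pmf_of_set A. P x \<bar> Q x) = real (card {x \<in> A. P x \<and> Q x}) / real (card {x \<in> A. Q x})"
  using assms prob_pmf_of_set[OF assms] by (simp add: cond_prob_def)

text \<open>Triples with a and b nonzero give genuine edges and are handled by averaging over
  automorphisms. All other triples leave M unchanged and pass automatically.\<close>

lemma shortcode_test_from_grassmann_test:
  assumes lm: "0 < l" "0 < m"
    and F: "\<And>V. V \<in> grassmann l (l + m) \<Longrightarrow> linear_functional_on V (F V)"
    and prob: "\<P>(e in pmf_of_set (grassmann_edges l (l + m)).
      case e of (V, V') \<Rightarrow> restrict (F V) (V \<inter> V') = restrict (F V') (V \<inter> V')) \<ge> \<delta>"
  obtains g where "g \<in> vs_aut (l + m)"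
    "\<P>(x in pmf_of_set (carrier_mat l m \<times> carrier_vec l \<times> carrier_vec m).
       case x of (M, a, b) \<Rightarrow> shortcode_map l g F (M + outer_prod a b) \<in>
         {shortcode_map l g F M, shortcode_map l g F M + a}) \<ge> \<delta>"
proof -
  let ?E = "grassmann_edges l (l + m)"
  let ?T = "carrier_mat l m \<times> carrier_vec l \<times> carrier_vec m :: (bit mat \<times> bit vec \<times> bit vec) set"
  define T where "T = {(M, a, b) \<in> ?T. a \<noteq> 0\<^sub>v l \<and> b \<noteq> 0\<^sub>v m}"
  define e where "e = (\<lambda>(M, a, b). (graph_space l M, graph_space l (M + outer_prod a b)))"
  define C where "C = {(V, V') \<in> ?E. restrict (F V) (V \<inter> V') = restrict (F V') (V \<inter> V')}"
  have fT: "finite ?T" by simp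
  have TT: "T \<subseteq> ?T" by (auto simp: T_def)
  have eE: "e t \<in> ?E" if "t \<in> T" for t
    using that graph_space_edge by (auto simp: T_def e_def)
  \<comment> \<open>Positive l and m provide nonzero vectors, so T and hence the edge set are
    nonempty.\<close>
  have "unit_vec l 0 \<noteq> 0\<^sub>v l" "unit_vec m 0 \<noteq> (0\<^sub>v m :: bit vec)"
    using lm unit_vec_nonzero by auto
  then have "(0\<^sub>m l m, unit_vec l 0, unit_vec m 0) \<in> T" by (auto simp: T_def)
  then have E: "?E \<noteq> {}" using eE by blast
  then have Epos: "0 < real (card ?E)" using finite_grassmann_edges by (simp add: card_gt_0_iff)
  have CE: "C \<subseteq> ?E" by (auto simp: C_def)
  have "{x \<in> ?E. case x of (V, V') \<Rightarrow> restrict (F V) (V \<inter> V') = restrict (F V') (V \<inter> V')} = C"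
    by (auto simp: C_def)
  then have dC: "\<delta> \<le> real (card C) / real (card ?E)"
    using prob unfolding prob_pmf_of_set[OF finite_grassmann_edges E] by simp
  also have "\<dots> \<le> 1" using card_mono[OF finite_grassmann_edges CE] Epos by (simp add: divide_le_eq_1_pos)
  finally have d1: "\<delta> \<le> 1" .
  obtain g where g: "g \<in> vs_aut (l + m)"
    and avg: "card C * card T \<le> card {t \<in> T. map_edge g (e t) \<in> C} * card ?E"
    using edge_averaging[OF finite_subset[OF TT fT] eE CE] .
  let ?f = "shortcode_map l g F"
  let ?good = "{t \<in> T. map_edge g (e t) \<in> C}"
  let ?pass = "{x \<in> ?T. case x of (M, a, b) \<Rightarrow> ?f (M + outer_prod a b) \<in> {?f M, ?f M + a}}"
  have sub: "?good \<union> (?T - T) \<subseteq> ?pass"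
  proof (intro Un_least subsetI)
    fix t assume t: "t \<in> ?good"
    obtain M a b where tt: "t = (M, a, b)" by (cases t)
    have c: "M \<in> carrier_mat l m" "a \<in> carrier_vec l" "b \<in> carrier_vec m"
      using t TT by (auto simp: tt)
    have "?f (M + outer_prod a b) \<in> {?f M, ?f M + a}"
      using t by (intro shortcode_map_consistent[OF F g c refl refl]) (auto simp: tt e_def C_def map_edge_def)
    then show "t \<in> ?pass" using c by (simp add: tt)
  next
    fix t assume t: "t \<in> ?T - T"
    obtain M a b where tt: "t = (M, a, b)" by (cases t)
    have c: "M \<in> carrier_mat l m" "a \<in> carrier_vec l" "b \<in> carrier_vec m"
      and z: "a = 0\<^sub>v l \<or> b = 0\<^sub>v m"
      using t by (auto simp: tt T_def)
    have "M + outer_prod a b = M"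
      using c z by (intro eq_matI) (auto simp: outer_prod_def)
    then show "t \<in> ?pass" using c by (simp add: tt)
  qed
  have "card ?good + (card ?T - card T) = card (?good \<union> (?T - T))"
  proof -
    have "card (?T - T) = card ?T - card T"
      using TT finite_subset[OF TT fT] by (rule card_Diff_subset[rotated])
    moreover have "finite ?good" using finite_subset[OF TT fT] by simp
    ultimately show ?thesis using fT by (subst card_Un_disjoint) auto
  qed
  also have "\<dots> \<le> card ?pass" using sub fT by (intro card_mono) auto
  finally have pass: "card ?good + (card ?T - card T) \<le> card ?pass" .
  have "\<delta> * real (card T) \<le> real (card C) / real (card ?E) * real (card T)"
    using dC by (rule mult_right_mono) simp
  also have "\<dots> \<le> real (card ?good)"
    using avg Epos by (simp add: divide_le_eq flip: of_nat_mult)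
  finally have "\<delta> * real (card T) + (real (card ?T) - real (card T)) \<le> real (card ?pass)"
    using pass card_mono[OF fT TT] by linarith
  \<comment> \<open>As \<open>\<delta> \<le> 1\<close>, the degenerate triples, which all pass,
    contribute at least their share.\<close>
  moreover have "\<delta> * (real (card ?T) - real (card T)) \<le> 1 * (real (card ?T) - real (card T))"
    using d1 of_nat_mono[OF card_mono[OF fT TT], where 'a = real] by (intro mult_right_mono) linarith+
  ultimately have "\<delta> * real (card ?T) \<le> real (card ?pass)" by (simp add: algebra_simps)
  moreover have Tne: "?T \<noteq> {}" using TT \<open>_ \<in> T\<close> by blast
  moreover have "0 < real (card ?T)" using Tne fT by (simp only: card_gt_0_iff of_nat_0_less_iff) simp
  ultimately have "\<delta> \<le> real (card ?pass) / real (card ?T)" by (simp add: le_divide_eq)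
  then show ?thesis using that[OF g] prob_pmf_of_set[OF fT Tne] by simp
qed

section \<open>Decoding\<close>

text \<open>The vectors on which two matrices agree form a subspace.\<close>

lemma mult_vec_eq_on_span:
  fixes A A' :: "bit mat"
  assumes "A \<in> carrier_mat l m" "A' \<in> carrier_mat l m" "set xs \<subseteq> carrier_vec m"
    and eq: "\<forall>x\<in>set xs. A *\<^sub>v x = A' *\<^sub>v x" and x: "x \<in> foldr adjoin xs {0\<^sub>v m}"
  shows "A *\<^sub>v x = A' *\<^sub>v x"
proof -
  let ?K = "{x \<in> carrier_vec m. A *\<^sub>v x = A' *\<^sub>v x}"
  have "A *\<^sub>v 0\<^sub>v m = A' *\<^sub>v 0\<^sub>v m" using assms(1,2) by (intro eq_vecI) auto
  then have "vsubspace m ?K"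
    using mult_add_distrib_mat_vec[OF assms(1)] mult_add_distrib_mat_vec[OF assms(2)]
    by (intro vsubspaceI) auto
  then have "foldr adjoin xs {0\<^sub>v m} \<subseteq> ?K"
    using assms(3) eq vsubspace_zero by (intro foldr_adjoin_subset) auto
  then show ?thesis using x by auto
qed

text \<open>A class K of matrices with fixed products on the spans P and R embeds into the interval
  I between Q and W, and good matrices become good spaces. Density \<epsilon> holds in some such
  class; passing from K to I costs the factor \<open>4 * 2 ^ (r * r)\<close>.\<close>

lemma grassmann_decoding_from_shortcode_decoding:
  fixes q t p s :: "nat \<Rightarrow> bit vec" and z u :: "bit vec"
  assumes \<epsilon>: "\<epsilon> > 0" and r: "r \<le> l" "r \<le> m"
    and F: "\<And>V. V \<in> grassmann l (l + m) \<Longrightarrow> linear_functional_on V (F V)"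
    and g: "g \<in> vs_aut (l + m)"
    and pq: "\<And>i. i < r \<Longrightarrow> p i \<in> carrier_vec l" "\<And>i. i < r \<Longrightarrow> q i \<in> carrier_vec m"
    and z: "z \<in> carrier_vec m" and u: "u \<in> carrier_vec l"
    and prob: "\<P>(M in pmf_of_set (carrier_mat l m). shortcode_map l g F M = M *\<^sub>v z + u \<bar>
        \<forall>i<r. M *\<^sub>v q i = t i \<and> transpose_mat M *\<^sub>v p i = s i) \<ge> \<epsilon>"
  shows "\<exists>Q W f. vsubspace (l + m) Q \<and> vdim (l + m) Q = r \<and>
      vsubspace (l + m) W \<and> vdim (l + m) W = l + m - r \<and>
      linear_functional_on (carrier_vec (l + m)) f \<and>
      \<P>(V in pmf_of_set (grassmann l (l + m)). restrict (F V) V = restrict f V \<bar>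
        Q \<subseteq> V \<and> V \<subseteq> W) \<ge> \<epsilon> / (4 * 2 ^ (r * r))"
proof -
  let ?n = "l + m" and ?X = "carrier_mat l m :: bit mat set" and ?f = "shortcode_map l g F"
  define S where "S = {M \<in> ?X. \<forall>i<r. M *\<^sub>v q i = t i \<and> transpose_mat M *\<^sub>v p i = s i}"
  define G where "G = {M \<in> S. ?f M = M *\<^sub>v z + u}"
  have fS: "finite S" by (simp add: S_def)
  have Xne: "?X \<noteq> {}" using zero_carrier_mat by blast
  have "{M \<in> ?X. ?f M = M *\<^sub>v z + u \<and> (\<forall>i<r. M *\<^sub>v q i = t i \<and> transpose_mat M *\<^sub>v p i = s i)} = G"
    by (auto simp: G_def S_def)
  then have \<epsilon>GS: "\<epsilon> \<le> real (card G) / real (card S)"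
    using prob unfolding cond_prob_pmf_of_set[OF finite_carrier_mat_bit Xne] S_def by simp
  \<comment> \<open>An empty S would make the quotient 0, against
    \<open>\<epsilon> > 0\<close>.\<close>
  then have "card S \<noteq> 0" using \<epsilon> by (cases "card S = 0") auto
  then have Sne: "S \<noteq> {}" and GS: "\<epsilon> * real (card S) \<le> real (card G)"
    using \<epsilon>GS by (auto simp: le_divide_eq)

  \<comment> \<open>The spans of bs and cs contain all \<open>p i\<close> and all \<open>q i\<close>
    and have dimension exactly r.\<close>
  obtain bs where bs: "length bs = r" "set bs \<subseteq> carrier_vec l" "indep_over {0\<^sub>v l} bs"
    "p ` {..<r} \<subseteq> foldr adjoin bs {0\<^sub>v l}"
    using indep_list_spanning[of "map p [0..<r]" l] pq r by (auto simp: lessThan_atLeast0 image_subset_iff)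
  obtain cs where cs: "length cs = r" "set cs \<subseteq> carrier_vec m" "indep_over {0\<^sub>v m} cs"
    "q ` {..<r} \<subseteq> foldr adjoin cs {0\<^sub>v m}"
    using indep_list_spanning[of "map q [0..<r]" m] pq r by (auto simp: lessThan_atLeast0 image_subset_iff)
  define P where "P = foldr adjoin bs {0\<^sub>v l}"
  define R where "R = foldr adjoin cs {0\<^sub>v m}"
  have P: "vsubspace l P" "card P = 2 ^ r"
    using vsubspace_foldr_adjoin[OF vsubspace_trivial bs(2)]
      card_foldr_adjoin[OF vsubspace_trivial bs(2,3)] bs(1) by (simp_all add: P_def)
  have R: "vsubspace m R" "card R = 2 ^ r"
    using vsubspace_foldr_adjoin[OF vsubspace_trivial cs(2)]
      card_foldr_adjoin[OF vsubspace_trivial cs(2,3)] cs(1) by (simp_all add: R_def)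

  \<comment> \<open>\<open>\<kappa>\<close> records the products with both bases, hence with all of
    P and R; this refines the condition that defines S.\<close>
  define \<kappa> where "\<kappa> M = (restrict (\<lambda>p. transpose_mat M *\<^sub>v p) (set bs), restrict (\<lambda>q. M *\<^sub>v q) (set cs))"
    for M :: "bit mat"
  have \<kappa>_eq: "\<kappa> M = \<kappa> M' \<longleftrightarrow> (\<forall>p\<in>set bs. transpose_mat M *\<^sub>v p = transpose_mat M' *\<^sub>v p) \<and>
    (\<forall>q\<in>set cs. M *\<^sub>v q = M' *\<^sub>v q)" for M M'
    by (auto simp: \<kappa>_def restrict_def fun_eq_iff split: if_splits)
  obtain M0 where M0: "M0 \<in> S"
    and avg: "\<epsilon> * real (card {M \<in> S. \<kappa> M = \<kappa> M0}) \<le> real (card {M \<in> G. \<kappa> M = \<kappa> M0})"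
    using fiber_averaging[of S G \<epsilon> \<kappa>] fS Sne GS by (auto simp: G_def)
  have M0X: "M0 \<in> ?X" using M0 by (simp add: S_def)
  have agree: "(\<forall>p\<in>P. transpose_mat M *\<^sub>v p = transpose_mat M0 *\<^sub>v p) \<and> (\<forall>q\<in>R. M *\<^sub>v q = M0 *\<^sub>v q)"
    if "M \<in> ?X" "\<kappa> M = \<kappa> M0" for M
    using that M0X mult_vec_eq_on_span[of "transpose_mat M" m l "transpose_mat M0" bs]
      mult_vec_eq_on_span[of M l m M0 cs] bs(2) cs(2) by (simp add: P_def R_def \<kappa>_eq)
  define K where "K = {M \<in> ?X. \<kappa> M = \<kappa> M0}"
  \<comment> \<open>M0 meets the conditions of S, and matrices of its class agree with it at every
    \<open>p i\<close> and \<open>q i\<close>, so the whole class lies in S.\<close>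
  have KS: "{M \<in> S. \<kappa> M = \<kappa> M0} = K"
  proof -
    have "M \<in> S" if "M \<in> ?X" "\<kappa> M = \<kappa> M0" for M
      using agree[OF that] that(1) M0 bs(4) cs(4) by (auto simp: S_def P_def R_def)
    then show ?thesis by (auto simp: K_def S_def)
  qed
  have "2 ^ (l * m) \<le> card K * 2 ^ (r * m + r * l)"
    using card_mat_constraint_class_ge[of "set bs" r l "set cs" m M0] bs cs M0X card_length[of bs] card_length[of cs]
    by (simp add: K_def \<kappa>_eq)
  note K_ge = this

  \<comment> \<open>As M and M0 agree on P and R, every graph space with M in K contains Q0 and is
    orthogonal to R0.\<close>
  define Q0 where "Q0 = graph_point M0 ` P"
  define R0 where "R0 = (\<lambda>q. (M0 *\<^sub>v q) @\<^sub>v q) ` R"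
  define W0 where "W0 = perp ?n R0"
  have Q0: "vsubspace ?n Q0" "card Q0 = 2 ^ r"
    using graph_point_image[OF M0X P(1)] P(2) by (simp_all add: Q0_def)
  have R0c: "R0 \<subseteq> carrier_vec ?n"
    using M0X vsubspace_carrier[OF R(1)] by (auto simp: R0_def)
  have W0: "vsubspace ?n W0" unfolding W0_def using R0c by (rule vsubspace_perp)
  have R0: "vsubspace ?n R0" "card R0 = 2 ^ r"
  proof -
    note c = vsubspace_carrier[OF R(1)]
    show "vsubspace ?n R0"
    proof (rule vsubspaceI[OF R0c])
      have "(M0 *\<^sub>v 0\<^sub>v m) @\<^sub>v 0\<^sub>v m = (0\<^sub>v ?n :: bit vec)"
        using M0X by (intro eq_vecI) auto
      then show "0\<^sub>v ?n \<in> R0" 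
        unfolding R0_def using vsubspace_zero[OF R(1)] by (intro image_eqI[of _ _ "0\<^sub>v m"]) simp_all
    next
      fix x y assume "x \<in> R0" "y \<in> R0"
      then obtain a b where ab: "a \<in> R" "b \<in> R" "x = (M0 *\<^sub>v a) @\<^sub>v a" "y = (M0 *\<^sub>v b) @\<^sub>v b"
        by (auto simp: R0_def)
      have "x + y = (M0 *\<^sub>v (a + b)) @\<^sub>v (a + b)"
        using append_vec_add[of "M0 *\<^sub>v a" l "M0 *\<^sub>v b" a m b] mult_add_distrib_mat_vec[OF M0X]
          c ab M0X by simp
      then show "x + y \<in> R0" unfolding R0_def using vsubspace_add[OF R(1)] ab by blast
    qed
    have "inj_on (\<lambda>q. (M0 *\<^sub>v q) @\<^sub>v q) R"
    proof (rule inj_onI)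
      fix x y assume "x \<in> R" "y \<in> R" "(M0 *\<^sub>v x) @\<^sub>v x = (M0 *\<^sub>v y) @\<^sub>v y"
      then show "x = y" using append_vec_eq[of "M0 *\<^sub>v x" l "M0 *\<^sub>v y" x y] M0X c by simp
    qed
    from card_image[OF this] show "card R0 = 2 ^ r" using R(2) by (simp add: R0_def)
  qed
  have cardW0: "card W0 = 2 ^ (?n - r)"
  proof -
    have "card W0 * 2 ^ r = 2 ^ (?n - r) * 2 ^ r"
      using card_perp[OF R0(1)] R0(2) r by (simp add: W0_def flip: power_add)
    then show ?thesis by simp
  qed
  have between: "Q0 \<subseteq> graph_space l M \<and> graph_space l M \<subseteq> W0" if M: "M \<in> K" for M
  proof -
    have MX: "M \<in> ?X" using M by (simp add: K_def)
    have agr: "\<forall>p\<in>P. transpose_mat M *\<^sub>v p = transpose_mat M0 *\<^sub>v p" "\<forall>q\<in>R. M *\<^sub>v q = M0 *\<^sub>v q"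
      using agree[of M] M by (auto simp: K_def)
    have "graph_point M0 p \<in> graph_space l M" if p: "p \<in> P" for p
      using agr(1) p vsubspace_carrier[OF P(1) p] unfolding graph_space_def
      by (intro image_eqI[of _ _ p]) (simp_all add: graph_point_def)
    moreover have "graph_point M x \<in> W0" if x: "x \<in> carrier_vec l" for x
    proof -
      have "((M0 *\<^sub>v q) @\<^sub>v q) \<bullet> graph_point M x = 0" if q: "q \<in> R" for q
      proof -
        have qc: "q \<in> carrier_vec m" using vsubspace_carrier[OF R(1) q] .
        \<comment> \<open>Both summands equal the scalar product of M q with x, so they cancel in
          characteristic 2.\<close>
        have "((M0 *\<^sub>v q) @\<^sub>v q) \<bullet> graph_point M x = (M *\<^sub>v q) \<bullet> x + q \<bullet> (transpose_mat M *\<^sub>v x)"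
          unfolding graph_point_def
          using scalar_prod_append[of "M0 *\<^sub>v q" l q m x "transpose_mat M *\<^sub>v x"] M0X MX qc x agr(2) q
          by simp
        also have "q \<bullet> (transpose_mat M *\<^sub>v x) = (transpose_mat M *\<^sub>v x) \<bullet> q"
          using qc MX x by (intro comm_scalar_prod[of _ m]) auto
        also have "\<dots> = x \<bullet> (M *\<^sub>v q)" using transpose_vec_mult_scalar[OF MX qc x] .
        also have "\<dots> = (M *\<^sub>v q) \<bullet> x"
          using qc MX x by (intro comm_scalar_prod[of _ l]) auto
        finally show ?thesis by simp
      qed
      then show ?thesis using graph_point_carrier[OF MX x] by (auto simp: W0_def perp_def R0_def)
    qed
    ultimately show ?thesis by (auto simp: Q0_def graph_space_def)
  qed

  note iso = vs_autD[OF g]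
  note isoD = vs_isoD[OF iso]
  \<comment> \<open>The shortcode map reads F at images under g, so the interval has to be moved by
    g as well.\<close>
  define Q where "Q = g ` Q0"
  define W where "W = g ` W0"
  have Q: "vsubspace ?n Q" "card Q = 2 ^ r"
    using vs_iso_image[OF iso Q0(1) vsubspace_subset[OF Q0(1)]] Q0(2) by (simp_all add: Q_def)
  have W: "vsubspace ?n W" "card W = 2 ^ (?n - r)"
    using vs_iso_image[OF iso W0 vsubspace_subset[OF W0]] cardW0 by (simp_all add: W_def)
  \<comment> \<open>The decoded functional is the scalar product with (u, z), evaluated after
    undoing g.\<close>
  define w where "w = u @\<^sub>v z"
  have w: "w \<in> carrier_vec ?n" using u z by (simp add: w_def)
  define h where "h = inv_into (carrier_vec ?n) g"
  define f where "f x = w \<bullet> h x" for x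
  have hg: "h (g x) = x" if "x \<in> carrier_vec ?n" for x
    using inv_into_f_f[OF isoD(3) that] by (simp add: h_def)
  have f: "linear_functional_on (carrier_vec ?n) f"
  proof -
    have "f (x + y) = f x + f y" if xy: "x \<in> carrier_vec ?n" "y \<in> carrier_vec ?n" for x y
    proof -
      have "x \<in> g ` carrier_vec ?n" "y \<in> g ` carrier_vec ?n" using xy by (simp_all only: isoD(4))
      then obtain a b where ab: "a \<in> carrier_vec ?n" "b \<in> carrier_vec ?n" "x = g a" "y = g b"
        by (elim imageE) (rule that)
      have "x + y = g (a + b)" using isoD(6) ab by simp
      then show ?thesis using ab hg scalar_prod_add_distrib[OF w ab(1,2)] by (simp add: f_def)
    qed
    then show ?thesis by (simp add: linear_functional_on_iff[OF vsubspace_carrier_vec])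
  qed

  define I where "I = {V \<in> grassmann l ?n. Q \<subseteq> V \<and> V \<subseteq> W}"
  define H where "H = {V \<in> I. restrict (F V) V = restrict f V}"
  have fI: "finite I" using finite_grassmann by (simp add: I_def)
  have inI: "g ` graph_space l M \<in> I" if "M \<in> K" for M
    using between[OF that] grassmann_vs_aut[OF g graph_space_in_grassmann] that
    by (auto simp: I_def Q_def W_def K_def)
  have inH: "g ` graph_space l M \<in> H" if M: "M \<in> G" "\<kappa> M = \<kappa> M0" for M
  proof -
    have MX: "M \<in> ?X" using M by (simp add: G_def S_def)
    have "F (g ` graph_space l M) (g (graph_point M x)) = f (g (graph_point M x))"
      if x: "x \<in> carrier_vec l" for x
    proof -
      have "F (g ` graph_space l M) (g (graph_point M x)) = ?f M \<bullet> x"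
        using shortcode_map_scalar_prod[OF F g MX x] by simp
      also have "\<dots> = (M *\<^sub>v z) \<bullet> x + u \<bullet> x"
        using M(1) add_scalar_prod_distrib[of "M *\<^sub>v z" l u x] MX z u x by (simp add: G_def)
      also have "(M *\<^sub>v z) \<bullet> x = x \<bullet> (M *\<^sub>v z)"
        using MX z x by (intro comm_scalar_prod[of _ l]) auto
      also have "\<dots> = (transpose_mat M *\<^sub>v x) \<bullet> z"
        using transpose_vec_mult_scalar[OF MX z x] by simp
      also have "\<dots> = z \<bullet> (transpose_mat M *\<^sub>v x)"
        using MX z x by (intro comm_scalar_prod[of _ m]) auto
      also have "\<dots> + u \<bullet> x = w \<bullet> graph_point M x"
        unfolding w_def graph_point_def
        using scalar_prod_append[OF u z x, of "transpose_mat M *\<^sub>v x"] MX x by (simp add: add.commute)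
      also have "\<dots> = f (g (graph_point M x))"
        using hg graph_point_carrier[OF MX x] by (simp add: f_def)
      finally show ?thesis .
    qed
    then have "restrict (F (g ` graph_space l M)) (g ` graph_space l M) =
        restrict f (g ` graph_space l M)"
      by (intro restrict_ext) (auto simp: graph_space_def)
    moreover have "M \<in> K" using M MX by (simp add: K_def)
    ultimately show ?thesis using inI by (simp add: H_def)
  qed
  have "card {M \<in> G. \<kappa> M = \<kappa> M0} \<le> card H"
  proof (rule card_inj_on_le[where f = "\<lambda>M. g ` graph_space l M"])
    show "inj_on (\<lambda>M. g ` graph_space l M) {M \<in> G. \<kappa> M = \<kappa> M0}"
    proof (rule inj_onI)
      fix M M' assume M: "M \<in> {M \<in> G. \<kappa> M = \<kappa> M0}" "M' \<in> {M \<in> G. \<kappa> M = \<kappa> M0}"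
        and eq: "g ` graph_space l M = g ` graph_space l M'"
      have X: "M \<in> ?X" "M' \<in> ?X" using M by (auto simp: G_def S_def)
      have "graph_space l M \<subseteq> carrier_vec ?n" "graph_space l M' \<subseteq> carrier_vec ?n"
        using X graph_point_carrier by (auto simp: graph_space_def)
      then have "graph_space l M = graph_space l M'"
        using eq inj_on_image_eq_iff[OF isoD(3)] by blast
      then show "M = M'" using graph_space_inject[OF X] by simp
    qed
    show "(\<lambda>M. g ` graph_space l M) ` {M \<in> G. \<kappa> M = \<kappa> M0} \<subseteq> H" using inH by auto
    show "finite H" using fI by (simp add: H_def)
  qed
  then have HK: "\<epsilon> * real (card K) \<le> real (card H)" using avg KS by simp

  \<comment> \<open>Since l + m - r = (m - r) + l, the factor \<open>2 ^ (l * (l - r))\<close>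
    cancels and leaves only the constant 4.\<close>
  have "card I * 2 ^ (l * (l - r)) \<le> 4 * 2 ^ ((?n - r) * (l - r))"
    unfolding I_def using card_grassmann_interval_le[OF Q finite_vsubspace[OF W(1)] W(2) r(1)] .
  also have "(?n - r) * (l - r) = (m - r) * (l - r) + l * (l - r)"
    using r by (simp add: add.commute flip: distrib_right)
  finally have "card I * 2 ^ (l * (l - r)) \<le> (4 * 2 ^ ((m - r) * (l - r))) * 2 ^ (l * (l - r))"
    by (simp add: power_add)
  then have "card I \<le> 4 * 2 ^ ((m - r) * (l - r))"
    by (rule mult_right_le_imp_le) simp
  then have "card I * 2 ^ (r * m + r * l) \<le> 4 * 2 ^ ((m - r) * (l - r)) * 2 ^ (r * m + r * l)"
    by (rule mult_right_mono) simp
  \<comment> \<open>The exponents of the interval count and of the constraint count add up to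
    \<open>l * m\<close> plus \<open>r * r\<close>, so the loss depends on r alone.\<close>
  also have "\<dots> = 4 * 2 ^ (r * r) * 2 ^ (l * m)"
  proof -
    obtain a b where "l = r + a" "m = r + b" using r le_Suc_ex by blast
    then have "(m - r) * (l - r) + (r * m + r * l) = r * r + l * m" by (simp add: algebra_simps)
    then show ?thesis by (simp only: mult.assoc flip: power_add)
  qed
  also have "\<dots> \<le> 4 * 2 ^ (r * r) * (card K * 2 ^ (r * m + r * l))"
    using K_ge by (rule mult_left_mono) simp
  finally have "card I * 2 ^ (r * m + r * l) \<le> (4 * 2 ^ (r * r) * card K) * 2 ^ (r * m + r * l)"
    by (simp only: mult.assoc)
  then have IK: "card I \<le> 4 * 2 ^ (r * r) * card K" by (rule mult_right_le_imp_le) simp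

  \<comment> \<open>The image of the graph space of M0 shows that the conditioning event is
    nonempty.\<close>
  have "M0 \<in> K" using M0X by (simp add: K_def)
  then have Ine: "I \<noteq> {}" using inI by blast
  then have Ipos: "0 < real (card I)" using fI by (simp add: card_gt_0_iff)
  have "\<epsilon> / (4 * 2 ^ (r * r)) * real (card I) \<le> \<epsilon> / (4 * 2 ^ (r * r)) * real (4 * 2 ^ (r * r) * card K)"
    using IK \<epsilon> by (intro mult_left_mono of_nat_mono) auto
  also have "\<dots> = \<epsilon> * real (card K)" by simp
  also note HK
  finally have ratio: "\<epsilon> / (4 * 2 ^ (r * r)) \<le> real (card H) / real (card I)"
    using Ipos by (simp add: pos_le_divide_eq)
  have Gne: "grassmann l ?n \<noteq> {}" using Ine by (auto simp: I_def)
  have "{V \<in> grassmann l ?n. restrict (F V) V = restrict f V \<and> Q \<subseteq> V \<and> V \<subseteq> W} = H"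
    by (auto simp: H_def I_def)
  then have "\<P>(V in pmf_of_set (grassmann l ?n). restrict (F V) V = restrict f V \<bar>
      Q \<subseteq> V \<and> V \<subseteq> W) \<ge> \<epsilon> / (4 * 2 ^ (r * r))"
    using ratio unfolding cond_prob_pmf_of_set[OF finite_grassmann Gne] I_def[symmetric] by simp
  then show ?thesis using Q W f by (intro exI conjI) (auto simp: vdim_eq_iff)
qed

section \<open>Choice of the constants and of the thresholds\<close>

theorem theorem2:
  assumes "shortcode_soundness_hypothesis"
  shows "grassmann_soundness_hypothesis"
  unfolding grassmann_soundness_hypothesis_def
proof (intro allI impI)
  fix \<delta> :: real
  assume "\<delta> > 0"
  from assms[unfolded shortcode_soundness_hypothesis_def, THEN spec, THEN mp, OF this]
  obtain \<epsilon> and r :: nat where "\<epsilon> > 0" "r > 0" and ssh: "\<forall>\<^sub>F l in sequentially. \<forall>\<^sub>F n in sequentially.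
        \<forall>F :: bit mat \<Rightarrow> bit vec.
          F \<in> carrier_mat l n \<rightarrow> carrier_vec l \<longrightarrow>
          \<P>(x in pmf_of_set (carrier_mat l n \<times> carrier_vec l \<times> carrier_vec n).
              case x of (M, a, b) \<Rightarrow> F (M + outer_prod a b) \<in> {F M, F M + a}) \<ge> \<delta> \<longrightarrow>
          (\<exists>q t p s z u.
             (\<forall>i<r. q i \<in> carrier_vec n \<and> t i \<in> carrier_vec l \<and>
                    p i \<in> carrier_vec l \<and> s i \<in> carrier_vec n) \<and>
             z \<in> carrier_vec n \<and> u \<in> carrier_vec l \<and>
             \<P>(M in pmf_of_set (carrier_mat l n). F M = M *\<^sub>v z + u \<bar>
                 \<forall>i<r. M *\<^sub>v q i = t i \<and> transpose_mat M *\<^sub>v p i = s i) \<ge> \<epsilon>)"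
      (is "\<forall>\<^sub>F l in _. \<forall>\<^sub>F n in _. ?D l n")
    by (elim exE conjE) (rule that)
  \<comment> \<open>The divisor is the cost of comparing a class of matrices with an interval of
    subspaces; \<delta> and r are kept.\<close>
  let ?\<epsilon> = "\<epsilon> / (4 * 2 ^ (r * r))"
  let ?G = "\<lambda>l n. \<forall>F :: bit vec set \<Rightarrow> bit vec \<Rightarrow> bit.
          (\<forall>V\<in>grassmann l n. linear_functional_on V (F V)) \<longrightarrow>
          \<P>(e in pmf_of_set (grassmann_edges l n).
              case e of (V, V') \<Rightarrow> restrict (F V) (V \<inter> V') = restrict (F V') (V \<inter> V')) \<ge> \<delta> \<longrightarrow>
          (\<exists>Q W f.
             vsubspace n Q \<and> vdim n Q = r \<and>
             vsubspace n W \<and> vdim n W = n - r \<and>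
             linear_functional_on (carrier_vec n) f \<and>
             \<P>(V in pmf_of_set (grassmann l n). restrict (F V) V = restrict f V \<bar>
                 Q \<subseteq> V \<and> V \<subseteq> W) \<ge> ?\<epsilon>)"
  have transfer: "?G l (l + m)" if "r \<le> l" "r \<le> m" "?D l m" for l m
  proof (intro allI impI)
    fix F :: "bit vec set \<Rightarrow> bit vec \<Rightarrow> bit"
    assume F: "\<forall>V\<in>grassmann l (l + m). linear_functional_on V (F V)"
      and test: "\<P>(e in pmf_of_set (grassmann_edges l (l + m)).
              case e of (V, V') \<Rightarrow> restrict (F V) (V \<inter> V') = restrict (F V') (V \<inter> V')) \<ge> \<delta>"
    have pos: "0 < l" "0 < m" using that \<open>r > 0\<close> by auto
    obtain g where g: "g \<in> vs_aut (l + m)" and sc: "\<P>(x in pmf_of_set (carrier_mat l m \<times> carrier_vec l \<times> carrier_vec m).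
       case x of (M, a, b) \<Rightarrow> shortcode_map l g F (M + outer_prod a b) \<in>
         {shortcode_map l g F M, shortcode_map l g F M + a}) \<ge> \<delta>"
      using shortcode_test_from_grassmann_test[OF pos bspec[OF F] test] .
    have "shortcode_map l g F \<in> carrier_mat l m \<rightarrow> carrier_vec l" by simp
    note that(3)[THEN spec, THEN mp, THEN mp, OF this sc]
    then obtain q t p s z u where
      d: "\<forall>i<r. q i \<in> carrier_vec m \<and> t i \<in> carrier_vec l \<and> p i \<in> carrier_vec l \<and> s i \<in> carrier_vec m"
         "z \<in> carrier_vec m" "u \<in> carrier_vec l"
         "\<P>(M in pmf_of_set (carrier_mat l m). shortcode_map l g F M = M *\<^sub>v z + u \<bar>
                 \<forall>i<r. M *\<^sub>v q i = t i \<and> transpose_mat M *\<^sub>v p i = s i) \<ge> \<epsilon>"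
      by (elim exE conjE) (rule that)
    show "\<exists>Q W f. vsubspace (l + m) Q \<and> vdim (l + m) Q = r \<and>
             vsubspace (l + m) W \<and> vdim (l + m) W = l + m - r \<and>
             linear_functional_on (carrier_vec (l + m)) f \<and>
             \<P>(V in pmf_of_set (grassmann l (l + m)). restrict (F V) V = restrict f V \<bar>
                 Q \<subseteq> V \<and> V \<subseteq> W) \<ge> ?\<epsilon>"
      using d(1) by (intro grassmann_decoding_from_shortcode_decoding[OF \<open>\<epsilon> > 0\<close> that(1,2) bspec[OF F] g _ _ d(2-4)])
        auto
  qed
  have "\<forall>\<^sub>F l in sequentially. \<forall>\<^sub>F n in sequentially. ?G l n"
    using ssh eventually_ge_at_top[of r]
  proof eventually_elim
    case (elim l)
    \<comment> \<open>The hypothesis is applied to matrices with n - l columns, a number that tends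
      to infinity with n for fixed l. The threshold l + r then ensures that
      \<open>l + (n - l) = n\<close> and \<open>r \<le> n - l\<close>.\<close>
    have "\<forall>\<^sub>F n in sequentially. ?D l (n - l)"
      using elim(1) filterlim_minus_const_nat_at_top by (rule eventually_compose_filterlim)
    then show ?case
      using eventually_ge_at_top[of "l + r"]
    proof eventually_elim
      case (elim n)
      then show ?case using transfer[OF \<open>r \<le> l\<close>, of "n - l"] by simp
    qed
  qed
  then show "\<exists>(\<epsilon>::real) (r::nat). \<epsilon> > 0 \<and> r > 0 \<and> (\<forall>\<^sub>F l in sequentially. \<forall>\<^sub>F n in sequentially.
        \<forall>F :: bit vec set \<Rightarrow> bit vec \<Rightarrow> bit.
          (\<forall>V\<in>grassmann l n. linear_functional_on V (F V)) \<longrightarrow>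
          \<P>(e in pmf_of_set (grassmann_edges l n).
              case e of (V, V') \<Rightarrow> restrict (F V) (V \<inter> V') = restrict (F V') (V \<inter> V')) \<ge> \<delta> \<longrightarrow>
          (\<exists>Q W f.
             vsubspace n Q \<and> vdim n Q = r \<and>
             vsubspace n W \<and> vdim n W = n - r \<and>
             linear_functional_on (carrier_vec n) f \<and>
             \<P>(V in pmf_of_set (grassmann l n). restrict (F V) V = restrict f V \<bar>
                 Q \<subseteq> V \<and> V \<subseteq> W) \<ge> \<epsilon>))"
    using \<open>\<epsilon> > 0\<close> \<open>r > 0\<close> by (intro exI[of _ ?\<epsilon>] exI[of _ r] conjI) auto
qed

end
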